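(* Let $S\subset\mathbb R^n$ be a closed subset. The map sending $h\in\bigl(G_b^{k,\omega}(S)\bigr)^*$ to the function $s\mapsto h(\delta_s^0)$, $s\in S$ (that is, restriction of $h$ to the set $\{\delta_s^0 : s\in S\}\subset G_b^{k,\omega}(S)$), is an isometric isomorphism of the dual space $\bigl(G_b^{k,\omega}(S)\bigr)^*$ onto $C_b^{k,\omega}(S)$.
   Context: Let $n\in\mathbb N$, $k\in\mathbb Z_+$, and let $\omega:(0,\infty)\to(0,\infty)$ be a modulus of continuity, meaning that (i) $\omega(t)$ and $t/\omega(t)$ are nondecreasing on $(0,\infty)$, and (ii) $\lim_{t\to0^+}\omega(t)=0$. All functions are real-valued and $\|\cdot\|$ on $\mathbb R^n$ is the Euclidean norm. $C_b^{k,\omega}(\mathbb R^n)$ is the Banach space of $f\in C^k(\mathbb R^n)$ with finite norm $\|f\|_{C_b^{k,\omega}(\mathbb R^n)}:=\max\bigl(\|f\|_{C_b^k(\mathbb R^n)},|f|_{C_b^{k,\omega}(\mathbb R^n)}\bigr)$, where $\|f\|_{C_b^k(\mathbb R^n)}:=\max_{|\alpha|\le k}\sup_{x}|D^\alpha f(x)|$ and $|f|_{C_b^{k,\omega}(\mathbb R^n)}:=\max_{|\alpha|=k}\sup_{x\neq y}\frac{|D^\alpha f(x)-D^\alpha f(y)|}{\omega(\|x-y\|)}$. For closed $S\subset\mathbb R^n$, $C_b^{k,\omega}(S)$ is the space of restrictions $f|_S$, $f\in C_b^{k,\omega}(\mathbb R^n)$, with the quotient norm $\|g\|_{C_b^{k,\omega}(S)}:=\inf\{\|\tilde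 g\|_{C_b^{k,\omega}(\mathbb R^n)}:\tilde g|_S=g\}$. For $x\in\mathbb R^n$, $\delta_x^0\in\bigl(C_b^{k,\omega}(\mathbb R^n)\bigr)^*$ is evaluation at $x$. $G_b^{k,\omega}(S)\subset\bigl(C_b^{k,\omega}(\mathbb R^n)\bigr)^*$ is the minimal closed subspace containing all $\delta_x^0$, $x\in S$, with the induced norm. *)

theory Defs
  imports "HOL-Analysis.Analysis" "HOL-Library.Function_Algebras"
begin

text \<open>Real-valued functions on a type form a real vector space with pointwise operations.
  This makes \<open>+\<close>, \<open>-\<close>, \<open>*\<^sub>R\<close> and \<open>subspace\<close> available for functions and for functionals.\<close>

instantiation "fun" :: (type, real_vector) real_vector
begin

definition scaleR_fun :: "real \<Rightarrow> ('a \<Rightarrow> 'b) \<Rightarrow> 'a \<Rightarrow> 'b" where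
  "c *\<^sub>R f = (\<lambda>x. c *\<^sub>R f x)"

instance
  by standard (simp_all add: scaleR_fun_def fun_eq_iff scaleR_add_right scaleR_add_left)

end


section \<open>Normed spaces on a carrier, and their duals\<close>

text \<open>A normed space is given by a carrier \<open>V\<close> (a linear subspace of a type of vectors) and a
  norm \<open>N\<close> that is meaningful on \<open>V\<close> only.\<close>

definition lin_on :: "'a::real_vector set \<Rightarrow> ('a \<Rightarrow> 'b::real_vector) \<Rightarrow> bool" where
  "lin_on V T \<longleftrightarrow>
     (\<forall>u\<in>V. \<forall>v\<in>V. T (u + v) = T u + T v) \<and> (\<forall>c. \<forall>v\<in>V. T (c *\<^sub>R v) = c *\<^sub>R T v)"

text \<open>Functionals are set to 0 off the carrier, so that two functionals on \<open>V\<close> are equal iff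
  they are equal as HOL functions, and the operations on functionals are pointwise.\<close>

definition dual_space :: "'a::real_vector set \<Rightarrow> ('a \<Rightarrow> real) \<Rightarrow> ('a \<Rightarrow> real) set" where
  "dual_space V N =
     {\<phi>. lin_on V \<phi> \<and> (\<exists>B. \<forall>v\<in>V. \<bar>\<phi> v\<bar> \<le> B * N v) \<and> (\<forall>v. v \<notin> V \<longrightarrow> \<phi> v = 0)}"

definition dual_norm :: "'a::real_vector set \<Rightarrow> ('a \<Rightarrow> real) \<Rightarrow> ('a \<Rightarrow> real) \<Rightarrow> real" where
  "dual_norm V N \<phi> = (SUP v\<in>{v\<in>V. N v \<le> 1}. \<bar>\<phi> v\<bar>)"

definition closed_subspace :: "'a::real_vector set \<Rightarrow> ('a \<Rightarrow> real) \<Rightarrow> 'a set \<Rightarrow> bool" where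
  "closed_subspace V N W \<longleftrightarrow> W \<subseteq> V \<and> subspace W \<and>
     (\<forall>w v. (\<forall>m::nat. w m \<in> W) \<and> v \<in> V \<and> (\<lambda>m. N (w m - v)) \<longlonglongrightarrow> 0 \<longrightarrow> v \<in> W)"

definition closed_hull :: "'a::real_vector set \<Rightarrow> ('a \<Rightarrow> real) \<Rightarrow> 'a set \<Rightarrow> 'a set" where
  "closed_hull V N A = \<Inter>{W. closed_subspace V N W \<and> A \<subseteq> W}"

definition isometric_isomorphism ::
  "'a::real_vector set \<Rightarrow> ('a \<Rightarrow> real) \<Rightarrow> 'b::real_vector set \<Rightarrow> ('b \<Rightarrow> real) \<Rightarrow> ('a \<Rightarrow> 'b) \<Rightarrow> bool"
  where
  "isometric_isomorphism V NV W NW T \<longleftrightarrow>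
     lin_on V T \<and> bij_betw T V W \<and> (\<forall>v\<in>V. NW (T v) = NV v)"


section \<open>The spaces of differentiable functions\<close>

definition modulus_of_continuity :: "(real \<Rightarrow> real) \<Rightarrow> bool" where
  "modulus_of_continuity \<omega> \<longleftrightarrow>
     (\<forall>t>0. \<omega> t > 0) \<and>
     mono_on {0<..} \<omega> \<and> mono_on {0<..} (\<lambda>t. t / \<omega> t) \<and>
     (\<omega> \<longlongrightarrow> 0) (at_right 0)"

definition partial :: "'n::finite \<Rightarrow> (real^'n \<Rightarrow> real) \<Rightarrow> real^'n \<Rightarrow> real" where
  "partial i f x = deriv (\<lambda>t. f (x + t *\<^sub>R axis i 1)) 0"

text \<open>\<open>C_k k f\<close>: all iterated partial derivatives of \<open>f\<close> of order at most \<open>k\<close> exist and are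
  continuous. In the successor case this includes the continuity of \<open>f\<close> itself, since existing
  continuous first-order partial derivatives make \<open>f\<close> differentiable.\<close>

primrec C_k :: "nat \<Rightarrow> (real^'n::finite \<Rightarrow> real) \<Rightarrow> bool" where
  "C_k 0 f \<longleftrightarrow> continuous_on UNIV f"
| "C_k (Suc k) f \<longleftrightarrow>
     (\<forall>i x. (\<lambda>t. f (x + t *\<^sub>R axis i 1)) differentiable (at 0)) \<and> (\<forall>i. C_k k (partial i f))"

text \<open>A multi-index is a function \<open>\<alpha> :: 'n \<Rightarrow> nat\<close>. The partial derivatives in
  \<open>D \<alpha> f\<close> are taken in the order of a fixed enumeration of the coordinates; for a function of
  class \<open>C_k k\<close> with \<open>mi_order \<alpha> \<le> k\<close> the order does not matter (Schwarz).\<close>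

definition mi_order :: "('n::finite \<Rightarrow> nat) \<Rightarrow> nat" where
  "mi_order \<alpha> = (\<Sum>i\<in>UNIV. \<alpha> i)"

definition coords :: "'n::finite list" where
  "coords = (SOME is. distinct is \<and> set is = UNIV)"

definition D :: "('n::finite \<Rightarrow> nat) \<Rightarrow> (real^'n \<Rightarrow> real) \<Rightarrow> real^'n \<Rightarrow> real" where
  "D \<alpha> f = foldr (\<lambda>i. partial i ^^ \<alpha> i) coords f"

definition Cb_norm :: "nat \<Rightarrow> (real^'n::finite \<Rightarrow> real) \<Rightarrow> real" where
  "Cb_norm k f = (MAX \<alpha>\<in>{\<alpha>. mi_order \<alpha> \<le> k}. SUP x. \<bar>D \<alpha> f x\<bar>)"

definition hoelder_quotients ::
  "(real \<Rightarrow> real) \<Rightarrow> (real^'n::finite \<Rightarrow> real) \<Rightarrow> real set" where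
  "hoelder_quotients \<omega> g = {\<bar>g x - g y\<bar> / \<omega> (norm (x - y)) | x y. x \<noteq> y}"

definition Cb_omega_seminorm ::
  "nat \<Rightarrow> (real \<Rightarrow> real) \<Rightarrow> (real^'n::finite \<Rightarrow> real) \<Rightarrow> real" where
  "Cb_omega_seminorm k \<omega> f =
     (MAX \<alpha>\<in>{\<alpha>. mi_order \<alpha> = k}. Sup (hoelder_quotients \<omega> (D \<alpha> f)))"

definition Cb_omega_norm ::
  "nat \<Rightarrow> (real \<Rightarrow> real) \<Rightarrow> (real^'n::finite \<Rightarrow> real) \<Rightarrow> real" where
  "Cb_omega_norm k \<omega> f = max (Cb_norm k f) (Cb_omega_seminorm k \<omega> f)"

text \<open>Finiteness of the norm has to be spelled out, as suprema of unbounded sets of reals have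
  an unspecified real value.\<close>

definition Cb_omega :: "nat \<Rightarrow> (real \<Rightarrow> real) \<Rightarrow> (real^'n::finite \<Rightarrow> real) set" where
  "Cb_omega k \<omega> = {f. C_k k f \<and>
     (\<forall>\<alpha>. mi_order \<alpha> \<le> k \<longrightarrow> bdd_above (range (\<lambda>x. \<bar>D \<alpha> f x\<bar>))) \<and>
     (\<forall>\<alpha>. mi_order \<alpha> = k \<longrightarrow> bdd_above (hoelder_quotients \<omega> (D \<alpha> f)))}"

text \<open>Functions on \<open>S\<close> are represented by functions on the whole type that vanish off \<open>S\<close>.\<close>

definition restr :: "'a set \<Rightarrow> ('a \<Rightarrow> real) \<Rightarrow> 'a \<Rightarrow> real" where
  "restr S f = (\<lambda>x. if x \<in> S then f x else 0)"

definition Cb_omega_on ::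
  "nat \<Rightarrow> (real \<Rightarrow> real) \<Rightarrow> (real^'n::finite) set \<Rightarrow> (real^'n \<Rightarrow> real) set" where
  "Cb_omega_on k \<omega> S = restr S ` Cb_omega k \<omega>"

definition Cb_omega_on_norm ::
  "nat \<Rightarrow> (real \<Rightarrow> real) \<Rightarrow> (real^'n::finite) set \<Rightarrow> (real^'n \<Rightarrow> real) \<Rightarrow> real" where
  "Cb_omega_on_norm k \<omega> S g = Inf {Cb_omega_norm k \<omega> f | f. f \<in> Cb_omega k \<omega> \<and> restr S f = g}"


section \<open>The predual\<close>

definition delta ::
  "nat \<Rightarrow> (real \<Rightarrow> real) \<Rightarrow> real^'n::finite \<Rightarrow> (real^'n \<Rightarrow> real) \<Rightarrow> real" where
  "delta k \<omega> x = (\<lambda>f. if f \<in> Cb_omega k \<omega> then f x else 0)"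

definition G_norm ::
  "nat \<Rightarrow> (real \<Rightarrow> real) \<Rightarrow> ((real^'n::finite \<Rightarrow> real) \<Rightarrow> real) \<Rightarrow> real" where
  "G_norm k \<omega> = dual_norm (Cb_omega k \<omega>) (Cb_omega_norm k \<omega>)"

definition G_space ::
  "nat \<Rightarrow> (real \<Rightarrow> real) \<Rightarrow> (real^'n::finite) set \<Rightarrow> ((real^'n \<Rightarrow> real) \<Rightarrow> real) set" where
  "G_space k \<omega> S =
     closed_hull (dual_space (Cb_omega k \<omega>) (Cb_omega_norm k \<omega>)) (G_norm k \<omega>) (delta k \<omega> ` S)"

end

theory Submission
  imports Defs
begin

text \<open>
  A bounded functional \<open>h\<close> on the predual is determined by its values on the evaluations, since
  their linear combinations are dense. The point is to find, for given \<open>h\<close>, a function of norm at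
  most \<open>\<parallel>h\<parallel>\<close> that takes the values \<open>h (delta k \<omega> s)\<close> on \<open>S\<close>; conversely every function
  acts on the predual, with at most its own norm, and these two facts together give the isometry.

  Such a function exists because the balls of \<open>Cb_omega k \<omega>\<close> are compact for pointwise
  convergence. Compactness reduces the problem to finite subsets of \<open>S\<close>, where it is solved by
  Helly's criterion (\<open>interpolation_finite\<close>), proved by minimising the least squares defect over
  the ball. This half of the argument works for any normed space of functions in which the norm
  bounds point evaluations and balls are pointwise closed; it ends with
  \<open>dual_isometric_to_restrictions\<close>.

  The other half is that balls are pointwise closed (\<open>closed_deriv_ball\<close>). Within a ball all
  derivatives of order at most \<open>k\<close> share a modulus of continuity: those of order \<open>k\<close> by definition
  of the norm, the lower ones because their partial derivatives are bounded. Difference quotients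
  then approximate partial derivatives uniformly over the ball, so that pointwise convergence of
  functions entails pointwise convergence of their partial derivatives
  (\<open>partial_pointwise_limit\<close>), and the bounds pass to the limit by induction on \<open>k\<close>. As the norm
  involves each mixed derivative in one order only, while membership in \<open>C_k\<close> concerns all orders,
  Schwarz's theorem (\<open>partial_commute\<close>) is needed to describe the balls recursively
  (\<open>Cb_omega_ball_iff\<close>).
\<close>

section \<open>Dual norms and closed hulls\<close>

lemma sum_apply: "(\<Sum>i\<in>A. f i) x = (\<Sum>i\<in>A. f i x :: real)"
  by (induction A rule: infinite_finite_induct) (auto simp: zero_fun_def)

lemma scaleR_apply: "(c *\<^sub>R f) x = c *\<^sub>R f x"
  by (simp add: scaleR_fun_def)

lemma subspace_kernel_on:
  assumes "subspace V" "lin_on V T"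
  shows "subspace {v \<in> V. T v = 0}"
proof -
  have "T 0 = 0"
  proof -
    have "T (0 *\<^sub>R 0) = 0 *\<^sub>R T 0"
      using assms subspace_0 unfolding lin_on_def by blast
    then show ?thesis by simp
  qed
  then show ?thesis
    using assms by (auto simp: subspace_def lin_on_def)
qed

locale seminormed_carrier =
  fixes V :: "'a::real_vector set" and N :: "'a \<Rightarrow> real"
  assumes subspace_V: "subspace V"
    and N_add: "\<lbrakk>u \<in> V; v \<in> V\<rbrakk> \<Longrightarrow> N (u + v) \<le> N u + N v"
    and N_scale: "v \<in> V \<Longrightarrow> N (c *\<^sub>R v) = \<bar>c\<bar> * N v"
begin

lemma N_zero: "N 0 = 0"
  using N_scale[of 0 0] subspace_0[OF subspace_V] by simp

lemma N_nonneg: "v \<in> V \<Longrightarrow> 0 \<le> N v"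
  using N_add[of v "(-1) *\<^sub>R v"] N_scale[of v "-1"] subspace_scale[OF subspace_V, of v "-1"] N_zero
  by simp

lemma dual_norm_bdd:
  assumes "\<phi> \<in> dual_space V N"
  shows "bdd_above ((\<lambda>v. \<bar>\<phi> v\<bar>) ` {v \<in> V. N v \<le> 1})"
proof -
  obtain B where B: "\<forall>v\<in>V. \<bar>\<phi> v\<bar> \<le> B * N v"
    using assms by (auto simp: dual_space_def)
  have "\<bar>\<phi> v\<bar> \<le> \<bar>B\<bar>" if "v \<in> V" "N v \<le> 1" for v
  proof -
    have "\<bar>\<phi> v\<bar> \<le> B * N v" using B that by blast
    also have "\<dots> \<le> \<bar>B\<bar> * N v" by (rule mult_right_mono) (use N_nonneg that in auto)
    also have "\<dots> \<le> \<bar>B\<bar> * 1" by (rule mult_left_mono) (use that in auto)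
    finally show ?thesis by simp
  qed
  then show ?thesis by (auto intro!: bdd_aboveI)
qed

lemma dual_norm_le:
  assumes "0 \<le> B" "\<And>v. v \<in> V \<Longrightarrow> \<bar>\<phi> v\<bar> \<le> B * N v"
  shows "dual_norm V N \<phi> \<le> B"
  unfolding dual_norm_def
proof (rule cSUP_least)
  show "{v \<in> V. N v \<le> 1} \<noteq> {}"
    using N_zero subspace_0[OF subspace_V] by force
  fix v assume v: "v \<in> {v \<in> V. N v \<le> 1}"
  have "\<bar>\<phi> v\<bar> \<le> B * N v" using v assms by blast
  also have "\<dots> \<le> B * 1" by (rule mult_left_mono) (use v assms in auto)
  finally show "\<bar>\<phi> v\<bar> \<le> B" by simp
qed

lemma dual_norm_bound:
  assumes \<phi>: "\<phi> \<in> dual_space V N" and v: "v \<in> V"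
  shows "\<bar>\<phi> v\<bar> \<le> dual_norm V N \<phi> * N v"
proof (cases "N v = 0")
  case True
  then show ?thesis using \<phi> v by (auto simp: dual_space_def)
next
  case False
  then have pos: "N v > 0" using N_nonneg[OF v] by simp
  let ?w = "(1 / N v) *\<^sub>R v"
  have w: "?w \<in> V" "N ?w \<le> 1"
    using pos v by (simp_all add: subspace_scale[OF subspace_V] N_scale)
  have "\<bar>\<phi> ?w\<bar> \<le> dual_norm V N \<phi>"
    unfolding dual_norm_def by (rule cSUP_upper[OF _ dual_norm_bdd[OF \<phi>]]) (use w in auto)
  moreover have "\<phi> ?w = \<phi> v / N v"
    using \<phi> v by (simp add: dual_space_def lin_on_def)
  ultimately show ?thesis
    using pos by (simp add: divide_simps)
qed

lemma dual_norm_nonneg: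
  assumes "\<phi> \<in> dual_space V N"
  shows "0 \<le> dual_norm V N \<phi>"
proof -
  have "\<bar>\<phi> 0\<bar> \<le> dual_norm V N \<phi>"
    unfolding dual_norm_def
    by (rule cSUP_upper[OF _ dual_norm_bdd[OF assms]])
       (use N_zero subspace_0[OF subspace_V] in auto)
  then show ?thesis by linarith
qed

lemma subspace_dual: "subspace (dual_space V N)"
proof (rule subspaceI)
  show "0 \<in> dual_space V N"
    by (auto simp: dual_space_def lin_on_def intro!: exI[of _ 0])
next
  fix \<phi> \<psi> assume A: "\<phi> \<in> dual_space V N" "\<psi> \<in> dual_space V N"
  have "\<bar>(\<phi> + \<psi>) v\<bar> \<le> (dual_norm V N \<phi> + dual_norm V N \<psi>) * N v" if "v \<in> V" for v
    using dual_norm_bound[OF A(1) that] dual_norm_bound[OF A(2) that]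
    by (simp add: distrib_right)
  then have "\<exists>B. \<forall>v\<in>V. \<bar>(\<phi> + \<psi>) v\<bar> \<le> B * N v" by blast
  then show "\<phi> + \<psi> \<in> dual_space V N"
    using A by (simp add: dual_space_def lin_on_def distrib_left)
next
  fix c \<phi> assume A: "\<phi> \<in> dual_space V N"
  have "\<bar>(c *\<^sub>R \<phi>) v\<bar> \<le> (\<bar>c\<bar> * dual_norm V N \<phi>) * N v" if "v \<in> V" for v
    using mult_left_mono[OF dual_norm_bound[OF A that], of "\<bar>c\<bar>"]
    by (simp add: scaleR_apply abs_mult mult.assoc)
  then have "\<exists>B. \<forall>v\<in>V. \<bar>(c *\<^sub>R \<phi>) v\<bar> \<le> B * N v" by blast
  then show "c *\<^sub>R \<phi> \<in> dual_space V N"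
    using A by (simp add: dual_space_def lin_on_def scaleR_apply distrib_left)
qed

text \<open>Duals can thus be iterated: the predual below is a subspace of a dual, and its own dual
  is taken in turn.\<close>

lemma seminormed_dual: "seminormed_carrier (dual_space V N) (dual_norm V N)"
proof
  show "subspace (dual_space V N)" by (rule subspace_dual)
next
  fix \<phi> \<psi> assume A: "\<phi> \<in> dual_space V N" "\<psi> \<in> dual_space V N"
  show "dual_norm V N (\<phi> + \<psi>) \<le> dual_norm V N \<phi> + dual_norm V N \<psi>"
  proof (rule dual_norm_le)
    show "0 \<le> dual_norm V N \<phi> + dual_norm V N \<psi>"
      using dual_norm_nonneg A by (simp add: add_nonneg_nonneg)
    show "\<bar>(\<phi> + \<psi>) v\<bar> \<le> (dual_norm V N \<phi> + dual_norm V N \<psi>) * N v" if "v \<in> V" for v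
      using dual_norm_bound[OF A(1) that] dual_norm_bound[OF A(2) that]
      by (simp add: distrib_right)
  qed
next
  fix \<phi> c assume A: "\<phi> \<in> dual_space V N"
  have "dual_norm V N (c *\<^sub>R \<phi>) = (SUP v\<in>{v \<in> V. N v \<le> 1}. \<bar>c\<bar> * \<bar>\<phi> v\<bar>)"
    by (simp add: dual_norm_def scaleR_apply abs_mult)
  also have "\<dots> = \<bar>c\<bar> * dual_norm V N \<phi>"
  proof -
    let ?A = "{v \<in> V. N v \<le> 1}"
    have ne: "(\<lambda>v. \<bar>\<phi> v\<bar>) ` ?A \<noteq> {}"
      using N_zero subspace_0[OF subspace_V] by force
    have "\<bar>c\<bar> * Sup ((\<lambda>v. \<bar>\<phi> v\<bar>) ` ?A) = (SUP x\<in>(\<lambda>v. \<bar>\<phi> v\<bar>) ` ?A. \<bar>c\<bar> * x)"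
    proof (rule continuous_at_Sup_mono[OF _ _ ne dual_norm_bdd[OF A]])
      show "mono ((*) \<bar>c\<bar>)" by (simp add: mono_def mult_left_mono)
      show "continuous (at_left (SUP v\<in>?A. \<bar>\<phi> v\<bar>)) ((*) \<bar>c\<bar>)"
        by (intro continuous_mult_left continuous_ident)
    qed
    then show ?thesis by (simp add: dual_norm_def image_image)
  qed
  finally show "dual_norm V N (c *\<^sub>R \<phi>) = \<bar>c\<bar> * dual_norm V N \<phi>" .
qed

lemma seminormed_subspace:
  assumes "subspace W" "W \<subseteq> V"
  shows "seminormed_carrier W N"
proof (rule seminormed_carrier.intro)
  show "subspace W" by fact
  show "N (u + v) \<le> N u + N v" if "u \<in> W" "v \<in> W" for u v
    using that assms(2) by (intro N_add) blast+
  show "N (c *\<^sub>R v) = \<bar>c\<bar> * N v" if "v \<in> W" for v c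
    using that assms(2) by (intro N_scale) blast
qed

lemma closed_subspace_carrier: "closed_subspace V N V"
  using subspace_V unfolding closed_subspace_def by blast

lemma subset_closed_hull: "A \<subseteq> closed_hull V N A"
  unfolding closed_hull_def by blast

lemma closed_hull_subset: "A \<subseteq> V \<Longrightarrow> closed_hull V N A \<subseteq> V"
  using closed_subspace_carrier unfolding closed_hull_def by blast

lemma closed_subspace_closed_hull:
  assumes "A \<subseteq> V"
  shows "closed_subspace V N (closed_hull V N A)"
proof -
  have "subspace (closed_hull V N A)"
    unfolding closed_hull_def by (rule subspace_Inter) (auto simp: closed_subspace_def)
  moreover have "v \<in> closed_hull V N A"
    if "\<forall>m::nat. w m \<in> closed_hull V N A" "v \<in> V" "(\<lambda>m. N (w m - v)) \<longlonglongrightarrow> 0" for w v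
    using that unfolding closed_hull_def closed_subspace_def by blast
  ultimately show ?thesis
    using closed_hull_subset[OF assms] by (auto simp: closed_subspace_def)
qed

text \<open>The kernel of a bounded functional is a closed subspace, so as soon as it contains
  \<open>A\<close> it contains the smallest closed subspace that does.\<close>

lemma functional_zero_on_closed_hull:
  assumes A: "A \<subseteq> V" and \<phi>: "\<phi> \<in> dual_space (closed_hull V N A) N"
    and zero: "\<And>a. a \<in> A \<Longrightarrow> \<phi> a = 0"
  shows "\<phi> v = 0"
proof -
  let ?G = "closed_hull V N A"
  have G: "closed_subspace V N ?G" by (rule closed_subspace_closed_hull[OF A])
  then have subG: "subspace ?G" "?G \<subseteq> V" by (auto simp: closed_subspace_def)
  interpret G: seminormed_carrier ?G N by (rule seminormed_subspace[OF subG])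
  have lin: "lin_on ?G \<phi>" and off: "v \<notin> ?G \<Longrightarrow> \<phi> v = 0" for v
    using \<phi> by (auto simp: dual_space_def)
  let ?K = "{v \<in> ?G. \<phi> v = 0}"
  have "closed_subspace V N ?K"
    unfolding closed_subspace_def
  proof (intro conjI allI impI)
    show "?K \<subseteq> V" using subG by auto
    show "subspace ?K" by (rule subspace_kernel_on[OF subG(1) lin])
    fix w :: "nat \<Rightarrow> 'a" and v
    assume H: "(\<forall>m. w m \<in> ?K) \<and> v \<in> V \<and> (\<lambda>m. N (w m - v)) \<longlonglongrightarrow> 0"
    then have w: "w m \<in> ?G" "\<phi> (w m) = 0" for m by auto
    have v: "v \<in> ?G" using G H w unfolding closed_subspace_def by blast
    have "\<bar>\<phi> v\<bar> \<le> dual_norm ?G N \<phi> * N (w m - v)" for m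
    proof -
      have d: "w m - v \<in> ?G" using w v subG(1) by (simp add: subspace_diff)
      have "\<phi> (w m) = \<phi> ((w m - v) + v)" by simp
      also have "\<dots> = \<phi> (w m - v) + \<phi> v"
        using lin d v unfolding lin_on_def by blast
      finally have "\<bar>\<phi> v\<bar> = \<bar>\<phi> (w m - v)\<bar>" using w by simp
      then show ?thesis using G.dual_norm_bound[OF \<phi> d] by simp
    qed
    moreover have "(\<lambda>m. dual_norm ?G N \<phi> * N (w m - v)) \<longlonglongrightarrow> dual_norm ?G N \<phi> * 0"
      using H by (intro tendsto_intros) auto
    ultimately have "\<bar>\<phi> v\<bar> \<le> dual_norm ?G N \<phi> * 0"
      by (intro LIMSEQ_le_const) auto
    then show "v \<in> ?K" using v by simp
  qed
  moreover have "A \<subseteq> ?K" using zero subset_closed_hull by auto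
  ultimately have "?G \<subseteq> ?K" unfolding closed_hull_def by auto
  then show ?thesis using off by blast
qed

end

section \<open>Preduals of function spaces with pointwise compact balls\<close>

text \<open>The one-sided first-order condition at a minimum: for small \<open>t\<close> the linear
  term decides the sign.\<close>

lemma nonneg_if_quadratic_nonneg:
  fixes a b :: real
  assumes "\<And>t. 0 < t \<Longrightarrow> t \<le> 1 \<Longrightarrow> 0 \<le> t * a + t\<^sup>2 * b"
  shows "0 \<le> a"
proof (rule ccontr)
  assume "\<not> 0 \<le> a"
  then have a: "a < 0" by simp
  \<comment> \<open>small enough for \<open>t * \<bar>b\<bar> \<le> - a / 2\<close>; the summand 1 avoids dividing by 0\<close>
  define t where "t = min 1 (- a / (2 * (\<bar>b\<bar> + 1)))"
  have t: "0 < t" "t \<le> 1" using divide_pos_pos[of "- a" "2 * (\<bar>b\<bar> + 1)"] a by (auto simp: t_def)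
  have "t * \<bar>b\<bar> \<le> t * (\<bar>b\<bar> + 1)" using t by simp
  also have "\<dots> \<le> - a / (2 * (\<bar>b\<bar> + 1)) * (\<bar>b\<bar> + 1)"
    by (rule mult_right_mono) (auto simp: t_def)
  also have "\<dots> = - a / 2" by (simp add: field_simps)
  finally have "a + t * b < 0" using a t mult_left_mono[OF abs_ge_self[of b], of t] by linarith
  then have "t * (a + t * b) < 0" using t by (simp add: mult_pos_neg)
  then show False using assms[OF t] by (simp add: algebra_simps power2_eq_square)
qed

text \<open>The only analytic input to the duality theorem. The topology on functions is that of
  pointwise convergence; as point evaluations are bounded by the norm, a ball lies in a product of
  compact intervals, so closed balls are compact.\<close>

locale compact_ball_function_space = seminormed_carrier V N
  for V :: "('a \<Rightarrow> real) set" and N :: "('a \<Rightarrow> real) \<Rightarrow> real" +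
  assumes eval_le: "f \<in> V \<Longrightarrow> \<bar>f x\<bar> \<le> N f"
    and closed_ball: "closed {f \<in> V. N f \<le> L}"
begin

definition evaluation :: "'a \<Rightarrow> ('a \<Rightarrow> real) \<Rightarrow> real" where
  "evaluation x = (\<lambda>f. if f \<in> V then f x else 0)"

definition predual :: "'a set \<Rightarrow> (('a \<Rightarrow> real) \<Rightarrow> real) set" where
  "predual S = closed_hull (dual_space V N) (dual_norm V N) (evaluation ` S)"

definition quotient_norm :: "'a set \<Rightarrow> ('a \<Rightarrow> real) \<Rightarrow> real" where
  "quotient_norm S g = Inf {N f | f. f \<in> V \<and> restr S f = g}"

sublocale dual: seminormed_carrier "dual_space V N" "dual_norm V N"
  by (rule seminormed_dual)

lemma evaluation_in_dual: "evaluation x \<in> dual_space V N"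
proof -
  have "\<bar>evaluation x f\<bar> \<le> 1 * N f" if "f \<in> V" for f
    using eval_le[OF that] that by (simp add: evaluation_def)
  then have "\<exists>B. \<forall>f\<in>V. \<bar>evaluation x f\<bar> \<le> B * N f" by blast
  then show ?thesis
    by (simp add: dual_space_def lin_on_def evaluation_def scaleR_apply
        subspace_add[OF subspace_V] subspace_scale[OF subspace_V])
qed

lemma predual_subset: "predual S \<subseteq> dual_space V N"
  unfolding predual_def by (rule dual.closed_hull_subset) (use evaluation_in_dual in auto)

lemma subspace_predual: "subspace (predual S)"
  using dual.closed_subspace_closed_hull[of "evaluation ` S"] evaluation_in_dual
  by (auto simp: predual_def closed_subspace_def)

lemma evaluation_in_predual: "s \<in> S \<Longrightarrow> evaluation s \<in> predual S"
  unfolding predual_def using dual.subset_closed_hull by blast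

lemma seminormed_predual: "seminormed_carrier (predual S) (dual_norm V N)"
  by (rule dual.seminormed_subspace[OF subspace_predual predual_subset])

text \<open>Tychonoff: the ball of radius \<open>L\<close> is a closed subset of the product of the
  intervals \<open>[-L, L]\<close>.\<close>

lemma compact_ball: "compact {f \<in> V. N f \<le> L}"
proof -
  have "compact (Pi\<^sub>E UNIV (\<lambda>_::'a. {- L..L}))"
    using compactin_PiE[of "\<lambda>_. euclidean" UNIV "\<lambda>_::'a. {- L..L}"]
    by (simp add: euclidean_product_topology)
  moreover have "{f \<in> V. N f \<le> L} \<subseteq> Pi\<^sub>E UNIV (\<lambda>_. {- L..L})"
  proof
    fix f assume f: "f \<in> {f \<in> V. N f \<le> L}"
    have "- L \<le> f x \<and> f x \<le> L" for x using eval_le[of f x] f by auto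
    then show "f \<in> Pi\<^sub>E UNIV (\<lambda>_. {- L..L})" by auto
  qed
  ultimately show ?thesis
    using closed_ball by (metis compact_Int_closed inf.absorb2)
qed

text \<open>Helly's criterion for finitely many interpolation conditions. Usually it is derived by
  separating a point from a convex set in a finite-dimensional space. Here the least squares defect
  is minimised over the compact ball instead. At a minimiser \<open>f0\<close> the residual
  \<open>r\<close> itself supplies the separating functional \<open>\<phi>\<close>: the first-order
  condition says that \<open>\<phi>\<close> is maximal at \<open>f0\<close> over the ball, hence
  \<open>L * \<parallel>\<phi>\<parallel> \<le> \<phi> f0\<close>, and the hypothesis for the
  coefficients \<open>r\<close> then forces \<open>\<Sum>r\<^sup>2 \<le> 0\<close>.\<close>

lemma interpolation_finite:
  assumes F: "finite F" and L: "0 \<le> L"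
    and le: "\<And>r. \<bar>\<Sum>s\<in>F. r s * p s\<bar> \<le> L * dual_norm V N (\<Sum>s\<in>F. r s *\<^sub>R evaluation s)"
  shows "\<exists>f\<in>V. N f \<le> L \<and> (\<forall>s\<in>F. f s = p s)"
proof -
  let ?B = "{f \<in> V. N f \<le> L}"
  have "0 \<in> ?B" using N_zero L subspace_0[OF subspace_V] by simp
  then have ne: "?B \<noteq> {}" by blast
  have cont: "continuous_on ?B (\<lambda>f. \<Sum>s\<in>F. (p s - f s)\<^sup>2)"
    by (intro continuous_intros continuous_on_subset[OF continuous_on_product_coordinates]) auto
  obtain f0 where f0: "f0 \<in> ?B"
    and min: "\<And>f. f \<in> ?B \<Longrightarrow> (\<Sum>s\<in>F. (p s - f0 s)\<^sup>2) \<le> (\<Sum>s\<in>F. (p s - f s)\<^sup>2)"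
    using continuous_attains_inf[OF compact_ball ne cont] by blast
  define r where "r s = p s - f0 s" for s
  define \<phi> where "\<phi> = (\<Sum>s\<in>F. r s *\<^sub>R evaluation s)"
  have \<phi>_dual: "\<phi> \<in> dual_space V N"
    unfolding \<phi>_def
    by (intro subspace_sum subspace_dual subspace_scale evaluation_in_dual)
  have \<phi>_eq: "\<phi> f = (\<Sum>s\<in>F. r s * f s)" if "f \<in> V" for f
    using that by (simp add: \<phi>_def sum_apply scaleR_apply evaluation_def)
  have max: "\<phi> f \<le> \<phi> f0" if f: "f \<in> ?B" for f
  proof -
    have "0 \<le> 2 * (\<phi> f0 - \<phi> f)"
    proof (rule nonneg_if_quadratic_nonneg)
      fix t :: real assume t: "0 < t" "t \<le> 1"
      let ?g = "(1 - t) *\<^sub>R f0 + t *\<^sub>R f"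
      have "N ?g \<le> N ((1 - t) *\<^sub>R f0) + N (t *\<^sub>R f)"
        using f f0 by (intro N_add subspace_scale[OF subspace_V]) auto
      also have "\<dots> = (1 - t) * N f0 + t * N f"
        using f f0 t by (simp add: N_scale)
      also have "\<dots> \<le> (1 - t) * L + t * L"
        using f f0 t by (intro add_mono mult_left_mono) auto
      finally have "?g \<in> ?B"
        using f f0 by (simp add: algebra_simps subspace_add[OF subspace_V]
            subspace_scale[OF subspace_V] subspace_diff[OF subspace_V])
      then have "(\<Sum>s\<in>F. (p s - f0 s)\<^sup>2) \<le> (\<Sum>s\<in>F. (p s - ?g s)\<^sup>2)"
        by (rule min)
      also have "\<dots> = (\<Sum>s\<in>F. (p s - f0 s)\<^sup>2 +
          (t * (2 * (r s * f0 s - r s * f s)) + t\<^sup>2 * (f s - f0 s)\<^sup>2))"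
        by (intro sum.cong refl)
           (simp add: r_def scaleR_apply algebra_simps power2_eq_square)
      also have "\<dots> = (\<Sum>s\<in>F. (p s - f0 s)\<^sup>2) +
          (t * (2 * (\<phi> f0 - \<phi> f)) + t\<^sup>2 * (\<Sum>s\<in>F. (f s - f0 s)\<^sup>2))"
        using f f0 by (simp add: \<phi>_eq sum.distrib sum_subtractf flip: sum_distrib_left)
      finally show "0 \<le> t * (2 * (\<phi> f0 - \<phi> f)) + t\<^sup>2 * (\<Sum>s\<in>F. (f s - f0 s)\<^sup>2)"
        by simp
    qed
    then show ?thesis by simp
  qed
  have "L * dual_norm V N \<phi> \<le> \<phi> f0"
  proof (cases "L = 0")
    case True
    have "\<phi> 0 = 0" using \<phi>_eq[of 0] subspace_0[OF subspace_V] by simp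
    then show ?thesis using max[OF \<open>0 \<in> ?B\<close>] True by simp
  next
    case False
    then have Lpos: "0 < L" using L by simp
    have "dual_norm V N \<phi> \<le> \<phi> f0 / L"
      unfolding dual_norm_def
    proof (rule cSUP_least)
      show "{v \<in> V. N v \<le> 1} \<noteq> {}"
        using N_zero subspace_0[OF subspace_V] by force
      fix v assume v: "v \<in> {v \<in> V. N v \<le> 1}"
      \<comment> \<open>both signs of \<open>c\<close> are needed to bound the absolute value of \<open>\<phi> v\<close>\<close>
      have "c * L * \<phi> v \<le> \<phi> f0" if "\<bar>c\<bar> = 1" for c
      proof -
        have "\<bar>c * L\<bar> * N v \<le> L * 1"
          using v Lpos that by (intro mult_mono) (auto simp: abs_mult N_nonneg)
        then have "(c * L) *\<^sub>R v \<in> ?B"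
          using v by (simp add: N_scale subspace_scale[OF subspace_V])
        moreover have "\<phi> ((c * L) *\<^sub>R v) = c * L * \<phi> v"
          using \<phi>_dual v by (simp add: dual_space_def lin_on_def)
        ultimately show ?thesis using max by metis
      qed
      from this[of 1] this[of "-1"] have "L * \<bar>\<phi> v\<bar> \<le> \<phi> f0"
        by (auto simp: abs_if)
      then show "\<bar>\<phi> v\<bar> \<le> \<phi> f0 / L" using Lpos by (simp add: field_simps)
    qed
    then show ?thesis using Lpos by (simp add: field_simps)
  qed
  then have "(\<Sum>s\<in>F. r s * p s) \<le> (\<Sum>s\<in>F. r s * f0 s)"
    using le[of r] f0 \<phi>_eq[of f0] by (simp add: \<phi>_def)
  moreover have "(\<Sum>s\<in>F. r s * p s) - (\<Sum>s\<in>F. r s * f0 s) = (\<Sum>s\<in>F. (r s)\<^sup>2)"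
    by (simp add: r_def sum_subtractf[symmetric] power2_eq_square algebra_simps)
  ultimately have "(\<Sum>s\<in>F. (r s)\<^sup>2) = 0"
    using sum_nonneg[of F "\<lambda>s. (r s)\<^sup>2"] by simp
  then have "\<forall>s\<in>F. r s = 0"
    using F by (simp add: sum_nonneg_eq_0_iff)
  then show ?thesis using f0 by (auto simp: r_def)
qed

text \<open>For a finite subset of \<open>S\<close> the bound \<open>\<bar>h \<phi>\<bar> \<le>
  \<parallel>h\<parallel> * \<parallel>\<phi>\<parallel>\<close> on linear combinations of
  evaluations is Helly's criterion, so the interpolation problem is solvable inside the ball of
  radius \<open>\<parallel>h\<parallel>\<close>. Each single condition cuts out a closed set, and
  the finite intersection property in the compact ball yields one function for all of
  \<open>S\<close>.\<close>

lemma dual_predual_representation: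
  assumes h: "h \<in> dual_space (predual S) (dual_norm V N)"
  shows "\<exists>f\<in>V. N f \<le> dual_norm (predual S) (dual_norm V N) h \<and> (\<forall>s\<in>S. f s = h (evaluation s))"
proof -
  interpret predual_S: seminormed_carrier "predual S" "dual_norm V N" by (rule seminormed_predual)
  define L where "L = dual_norm (predual S) (dual_norm V N) h"
  have L: "0 \<le> L" unfolding L_def by (rule predual_S.dual_norm_nonneg[OF h])
  have lin: "lin_on (predual S) h" using h by (simp add: dual_space_def)
  have fin: "\<exists>f\<in>V. N f \<le> L \<and> (\<forall>s\<in>F. f s = h (evaluation s))" if F: "finite F" "F \<subseteq> S" for F
  proof (rule interpolation_finite[OF F(1) L])
    fix r
    have comb: "(\<Sum>s\<in>F. r s *\<^sub>R evaluation s) \<in> predual S \<and>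
        h (\<Sum>s\<in>F. r s *\<^sub>R evaluation s) = (\<Sum>s\<in>F. r s * h (evaluation s))"
      using F
    proof (induction F rule: finite_induct)
      case empty
      have "h (0 *\<^sub>R 0) = 0 *\<^sub>R h 0" using lin subspace_0[OF subspace_predual] unfolding lin_on_def by blast
      then have "h 0 = 0" by (simp only: scaleR_zero_left)
      then show ?case using subspace_0[OF subspace_predual] by (simp only: sum.empty)
    next
      case (insert x F)
      have x: "evaluation x \<in> predual S" using insert by (intro evaluation_in_predual) auto
      then have "r x *\<^sub>R evaluation x \<in> predual S" by (rule subspace_scale[OF subspace_predual])
      moreover have "(\<Sum>s\<in>F. r s *\<^sub>R evaluation s) \<in> predual S" using insert by blast
      ultimately have "h (r x *\<^sub>R evaluation x + (\<Sum>s\<in>F. r s *\<^sub>R evaluation s)) =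
            r x *\<^sub>R h (evaluation x) + (\<Sum>s\<in>F. r s * h (evaluation s))"
        and "r x *\<^sub>R evaluation x + (\<Sum>s\<in>F. r s *\<^sub>R evaluation s) \<in> predual S"
        using insert x lin subspace_add[OF subspace_predual] unfolding lin_on_def by auto
      then show ?case using insert(1,2) by (simp only: sum.insert real_scaleR_def simp_thms)
    qed
    then show "\<bar>\<Sum>s\<in>F. r s * h (evaluation s)\<bar> \<le> L * dual_norm V N (\<Sum>s\<in>F. r s *\<^sub>R evaluation s)"
      using predual_S.dual_norm_bound[OF h] unfolding L_def by metis
  qed
  have "{f \<in> V. N f \<le> L} \<inter> (\<Inter>s\<in>S. {f. f s = h (evaluation s)}) \<noteq> {}"
  proof (rule compact_imp_fip_image[OF compact_ball])
    show "closed {f. f s = h (evaluation s)}" for s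
      by (intro closed_Collect_eq continuous_intros continuous_on_product_coordinates)
    show "{f \<in> V. N f \<le> L} \<inter> (\<Inter>s\<in>F. {f. f s = h (evaluation s)}) \<noteq> {}"
      if "finite F" "F \<subseteq> S" for F
      using fin[OF that] by auto
  qed
  then show ?thesis unfolding L_def by auto
qed

text \<open>A function as a functional on the predual, set to 0 off the carrier as membership in
  \<open>dual_space\<close> demands.\<close>

definition pairing :: "'a set \<Rightarrow> ('a \<Rightarrow> real) \<Rightarrow> (('a \<Rightarrow> real) \<Rightarrow> real) \<Rightarrow> real" where
  "pairing S f = (\<lambda>\<phi>. if \<phi> \<in> predual S then \<phi> f else 0)"

lemma pairing_in_dual:
  assumes f: "f \<in> V"
  shows "pairing S f \<in> dual_space (predual S) (dual_norm V N)"
    and "dual_norm (predual S) (dual_norm V N) (pairing S f) \<le> N f"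
    and "s \<in> S \<Longrightarrow> pairing S f (evaluation s) = f s"
proof -
  interpret predual_S: seminormed_carrier "predual S" "dual_norm V N" by (rule seminormed_predual)
  have bound: "\<bar>pairing S f \<phi>\<bar> \<le> N f * dual_norm V N \<phi>" if "\<phi> \<in> predual S" for \<phi>
    using dual_norm_bound[OF _ f, of \<phi>] that predual_subset by (auto simp: pairing_def mult.commute)
  then have "\<exists>B. \<forall>\<phi>\<in>predual S. \<bar>pairing S f \<phi>\<bar> \<le> B * dual_norm V N \<phi>" by blast
  then show "pairing S f \<in> dual_space (predual S) (dual_norm V N)"
    by (simp add: dual_space_def lin_on_def pairing_def scaleR_apply
        subspace_add[OF subspace_predual] subspace_scale[OF subspace_predual])
  show "dual_norm (predual S) (dual_norm V N) (pairing S f) \<le> N f"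
    by (rule predual_S.dual_norm_le[OF N_nonneg[OF f] bound])
  show "pairing S f (evaluation s) = f s" if "s \<in> S"
    using that f evaluation_in_predual by (simp add: pairing_def evaluation_def)
qed

lemma dual_predual_eqI:
  assumes h: "h \<in> dual_space (predual S) (dual_norm V N)"
    and h': "h' \<in> dual_space (predual S) (dual_norm V N)"
    and eq: "\<And>s. s \<in> S \<Longrightarrow> h (evaluation s) = h' (evaluation s)"
  shows "h = h'"
proof
  fix \<phi>
  interpret predual_S: seminormed_carrier "predual S" "dual_norm V N" by (rule seminormed_predual)
  have "(h - h') \<phi> = 0"
  proof (rule dual.functional_zero_on_closed_hull[of "evaluation ` S" "h - h'" \<phi>])
    show "evaluation ` S \<subseteq> dual_space V N" using evaluation_in_dual by auto
    show "h - h' \<in> dual_space (closed_hull (dual_space V N) (dual_norm V N) (evaluation ` S)) (dual_norm V N)"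
      using subspace_diff[OF predual_S.subspace_dual h h'] by (simp add: predual_def)
    show "(h - h') a = 0" if "a \<in> evaluation ` S" for a
      using that eq by auto
  qed
  then show "h \<phi> = h' \<phi>" by simp
qed

text \<open>Injectivity holds because evaluations span a dense subspace. A pairing with
  \<open>f\<close> is a preimage of the restriction of \<open>f\<close> and has norm at most
  \<open>N f\<close>; since the preimage is unique, the norm of \<open>h\<close> is a lower bound
  for all extensions of its image. The representing function of \<open>h\<close> shows that this
  lower bound is attained.\<close>

theorem dual_isometric_to_restrictions:
  "isometric_isomorphism
     (dual_space (predual S) (dual_norm V N)) (dual_norm (predual S) (dual_norm V N))
     (restr S ` V) (quotient_norm S)
     (\<lambda>h. restr S (\<lambda>s. h (evaluation s)))"
proof -
  let ?X = "dual_space (predual S) (dual_norm V N)"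
  let ?n = "dual_norm (predual S) (dual_norm V N)"
  let ?T = "\<lambda>h. restr S (\<lambda>s. h (evaluation s))"
  have lin: "lin_on ?X ?T"
    by (auto simp: lin_on_def restr_def scaleR_apply fun_eq_iff)
  have restr_eqD: "g s = g' s" if "restr S g = restr S g'" "s \<in> S" for g g' :: "'a \<Rightarrow> real" and s
    using fun_cong[OF that(1), of s] that(2) by (simp add: restr_def)
  have T_pairing: "?T (pairing S f) = restr S f" if "f \<in> V" for f
    using pairing_in_dual(3)[OF that] by (auto simp: restr_def fun_eq_iff)
  have lift: "\<exists>f\<in>V. N f \<le> ?n h \<and> restr S f = ?T h" if "h \<in> ?X" for h
    using dual_predual_representation[OF that] by (fastforce simp: restr_def fun_eq_iff)
  have inj: "inj_on ?T ?X"
  proof (rule inj_onI)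
    fix h h' assume h: "h \<in> ?X" "h' \<in> ?X" and eq: "?T h = ?T h'"
    show "h = h'" by (rule dual_predual_eqI[OF h restr_eqD[OF eq]])
  qed
  have image: "?T ` ?X = restr S ` V"
  proof
    show "?T ` ?X \<subseteq> restr S ` V"
    proof (rule image_subsetI)
      fix h assume "h \<in> ?X"
      from lift[OF this] obtain f where "f \<in> V" "restr S f = ?T h" by blast
      then show "?T h \<in> restr S ` V" by (metis imageI)
    qed
    show "restr S ` V \<subseteq> ?T ` ?X"
    proof (rule image_subsetI)
      fix f assume "f \<in> V"
      then show "restr S f \<in> ?T ` ?X"
        using imageI[OF pairing_in_dual(1), of f ?T S] T_pairing[of f] by simp
    qed
  qed
  have "quotient_norm S (?T h) = ?n h" if h: "h \<in> ?X" for h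
  proof -
    let ?A = "{N f | f. f \<in> V \<and> restr S f = ?T h}"
    obtain f0 where f0: "f0 \<in> V" "N f0 \<le> ?n h" "restr S f0 = ?T h"
      using lift[OF h] by blast
    have low: "?n h \<le> a" if a: "a \<in> ?A" for a
    proof -
      obtain f where f: "f \<in> V" "restr S f = ?T h" "a = N f" using a by blast
      have "?T (pairing S f) = ?T h" using T_pairing f by simp
      then have "pairing S f = h"
        using inj_onD[OF inj] pairing_in_dual(1)[OF f(1)] h by blast
      then show ?thesis using pairing_in_dual(2)[OF f(1)] f(3) by metis
    qed
    have mem: "N f0 \<in> ?A" using f0 by blast
    have "Inf ?A \<le> N f0" by (intro cInf_lower[OF mem] bdd_belowI[of _ "?n h"] low)
    moreover have "?n h \<le> Inf ?A"
    proof (rule cInf_greatest)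
      show "?A \<noteq> {}" using mem by blast
    qed (rule low)
    ultimately show ?thesis unfolding quotient_norm_def using f0(2) by linarith
  qed
  then show ?thesis
    using lin inj image by (simp add: isometric_isomorphism_def bij_betw_def)
qed

end

section \<open>Partial derivatives and Schwarz's theorem\<close>

definition has_partials :: "(real^'n::finite \<Rightarrow> real) \<Rightarrow> bool" where
  "has_partials f \<longleftrightarrow> (\<forall>i x. (\<lambda>t. f (x + t *\<^sub>R axis i 1)) differentiable (at 0))"

lemma C_k_Suc: "C_k (Suc k) f \<longleftrightarrow> has_partials f \<and> (\<forall>i. C_k k (partial i f))"
  by (simp add: has_partials_def)

lemma DERIV_coordinate_line:
  assumes "has_partials f"
  shows "((\<lambda>t. f (x + t *\<^sub>R axis i 1)) has_real_derivative partial i f (x + t *\<^sub>R axis i 1)) (at t)"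
proof -
  let ?g = "\<lambda>t. f (x + t *\<^sub>R axis i 1)"
  have "((\<lambda>s. f ((x + t *\<^sub>R axis i 1) + s *\<^sub>R axis i 1)) has_real_derivative
      partial i f (x + t *\<^sub>R axis i 1)) (at 0)"
    using assms unfolding has_partials_def partial_def
    by (simp only: DERIV_deriv_iff_real_differentiable)
  moreover have "(\<lambda>s. f ((x + t *\<^sub>R axis i 1) + s *\<^sub>R axis i 1)) = (\<lambda>s. ?g (s + t))"
    by (simp add: algebra_simps)
  ultimately show ?thesis using DERIV_shift[of ?g _ 0 t] by simp
qed

lemma partial_mean_value:
  assumes "has_partials f"
  obtains \<theta> where "0 < \<theta>" "\<theta> < 1"
    "f (x + t *\<^sub>R axis i 1) - f x = t * partial i f (x + (\<theta> * t) *\<^sub>R axis i 1)"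
proof -
  let ?g = "\<lambda>u. f (x + (u * t) *\<^sub>R axis i 1)"
  have "(?g has_real_derivative partial i f (x + (u * t) *\<^sub>R axis i 1) * t) (at u)" for u
    by (rule DERIV_chain2[OF DERIV_coordinate_line[OF assms]]) (auto intro!: derivative_eq_intros)
  then have "\<exists>\<theta>::real. 0 < \<theta> \<and> \<theta> < 1 \<and>
      ?g 1 - ?g 0 = (1 - 0) * (partial i f (x + (\<theta> * t) *\<^sub>R axis i 1) * t)"
    by (intro MVT2) auto
  then obtain \<theta> where "0 < \<theta>" "\<theta> < 1"
      "?g 1 - ?g 0 = partial i f (x + (\<theta> * t) *\<^sub>R axis i 1) * t" by auto
  then show thesis using that[of \<theta>] by (simp add: mult.commute)
qed

text \<open>Change \<open>x\<close> into \<open>y\<close> one coordinate at a time and apply the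
  mean value theorem on each step. The bound on the partial derivatives is only assumed on the box
  between \<open>x\<close> and \<open>y\<close>, so that the lemma serves both locally and
  globally.\<close>

lemma coordinatewise_mean_value_bound:
  fixes f :: "real^'n::finite \<Rightarrow> real"
  assumes f: "has_partials f"
    and B: "\<And>i z. (\<And>j. \<bar>z $ j - x $ j\<bar> \<le> \<bar>y $ j - x $ j\<bar>) \<Longrightarrow> \<bar>partial i f z\<bar> \<le> B"
  shows "\<bar>f y - f x\<bar> \<le> B * (\<Sum>j\<in>UNIV. \<bar>y $ j - x $ j\<bar>)"
proof -
  define z where "z A = (\<chi> j. if j \<in> A then y $ j else x $ j)" for A
  have "\<bar>f (z A) - f x\<bar> \<le> B * (\<Sum>j\<in>A. \<bar>y $ j - x $ j\<bar>)" if "finite A" for A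
    using that
  proof (induction A rule: finite_induct)
    case empty
    have "z {} = x" by (simp add: z_def vec_eq_iff)
    then show ?case by simp
  next
    case (insert i A)
    let ?d = "y $ i - x $ i"
    have step: "z (insert i A) = z A + ?d *\<^sub>R axis i 1"
      using insert by (auto simp: z_def vec_eq_iff axis_def)
    obtain \<theta> where \<theta>: "0 < \<theta>" "\<theta> < 1"
      "f (z A + ?d *\<^sub>R axis i 1) - f (z A) = ?d * partial i f (z A + (\<theta> * ?d) *\<^sub>R axis i 1)"
      using partial_mean_value[OF f] by blast
    have "\<bar>partial i f (z A + (\<theta> * ?d) *\<^sub>R axis i 1)\<bar> \<le> B"
    proof (rule B)
      fix j
      have "\<theta> * \<bar>?d\<bar> \<le> 1 * \<bar>?d\<bar>" by (rule mult_right_mono) (use \<theta> in auto)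
      then show "\<bar>(z A + (\<theta> * ?d) *\<^sub>R axis i 1) $ j - x $ j\<bar> \<le> \<bar>y $ j - x $ j\<bar>"
        using insert(2) \<theta> by (auto simp: z_def axis_def abs_mult)
    qed
    then have "\<bar>f (z (insert i A)) - f (z A)\<bar> \<le> B * \<bar>?d\<bar>"
      unfolding step \<theta>(3) abs_mult by (subst mult.commute) (intro mult_right_mono abs_ge_zero)
    moreover have "\<bar>f (z (insert i A)) - f x\<bar> \<le> \<bar>f (z (insert i A)) - f (z A)\<bar> + \<bar>f (z A) - f x\<bar>"
      by linarith
    ultimately have "\<bar>f (z (insert i A)) - f x\<bar> \<le> B * \<bar>?d\<bar> + B * (\<Sum>j\<in>A. \<bar>y $ j - x $ j\<bar>)"
      using insert.IH by linarith
    then show ?case using insert(1,2) by (simp add: distrib_left)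
  qed
  from this[of UNIV] show ?thesis by (simp add: z_def)
qed

text \<open>On a compact box around a point continuous partial derivatives are bounded, so
  \<open>f\<close> is Lipschitz there.\<close>

lemma continuous_if_continuous_partials:
  fixes f :: "real^'n::finite \<Rightarrow> real"
  assumes f: "has_partials f" and cont: "\<And>i. continuous_on UNIV (partial i f)"
  shows "continuous_on UNIV f"
proof -
  have "(f \<longlongrightarrow> f x) (at x)" for x
  proof -
    define K where "K = cbox (x - 1) (x + 1)"
    have "\<exists>b. \<forall>z\<in>K. \<bar>partial i f z\<bar> \<le> b" for i
    proof -
      have "compact (partial i f ` K)"
        unfolding K_def
        by (intro compact_continuous_image compact_cbox continuous_on_subset[OF cont]) auto
      then show ?thesis using compact_imp_bounded bounded_real by (metis imageI)
    qed
    then obtain b where b: "\<And>i z. z \<in> K \<Longrightarrow> \<bar>partial i f z\<bar> \<le> b i" by metis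
    define B where "B = (MAX i. b i)"
    have B: "\<bar>partial i f z\<bar> \<le> B" if "z \<in> K" for i z
      unfolding B_def by (rule order_trans[OF b[OF that, of i] Max_ge]) auto
    have bound: "\<bar>f y - f x\<bar> \<le> B * (\<Sum>j\<in>UNIV. \<bar>y $ j - x $ j\<bar>)" if y: "dist y x < 1" for y
    proof (rule coordinatewise_mean_value_bound[OF f B])
      fix z assume z: "\<And>j. \<bar>z $ j - x $ j\<bar> \<le> \<bar>y $ j - x $ j\<bar>"
      have "\<bar>z $ j - x $ j\<bar> \<le> 1" for j
        using z[of j] component_le_norm_cart[of "y - x" j] y by (simp add: dist_norm)
      then have "x $ j - 1 \<le> z $ j \<and> z $ j \<le> x $ j + 1" for j
        by (simp add: abs_le_iff algebra_simps)
      then show "z \<in> K" by (simp add: K_def mem_box_cart)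
    qed
    have "((\<lambda>y. B * (\<Sum>j\<in>UNIV. \<bar>y $ j - x $ j\<bar>)) \<longlongrightarrow> B * (\<Sum>j\<in>UNIV. \<bar>x $ j - x $ j\<bar>)) (at x)"
      by (intro tendsto_intros)
    then have "((\<lambda>y. B * (\<Sum>j\<in>UNIV. \<bar>y $ j - x $ j\<bar>)) \<longlongrightarrow> 0) (at x)" by simp
    moreover have "eventually (\<lambda>y. norm (f y - f x) \<le> B * (\<Sum>j\<in>UNIV. \<bar>y $ j - x $ j\<bar>)) (at x)"
      unfolding eventually_at using bound by (intro exI[of _ 1]) auto
    ultimately have "((\<lambda>y. f y - f x) \<longlongrightarrow> 0) (at x)" by (rule Lim_null_comparison[rotated])
    then show ?thesis by (simp add: LIM_zero_iff)
  qed
  then show ?thesis by (simp add: continuous_on_def)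
qed

text \<open>The definition of \<open>C_k\<close> mentions continuity at the highest order only; this
  recovers it for lower orders.\<close>

lemma C_k_pred: "C_k (Suc k) f \<Longrightarrow> C_k k f"
proof (induction k arbitrary: f)
  case 0
  then show ?case
    unfolding C_k_Suc using continuous_if_continuous_partials by (metis C_k.simps(1))
next
  case (Suc k)
  then show ?case unfolding C_k_Suc[of "Suc k"] C_k_Suc[of k f] by blast
qed

text \<open>The second difference is symmetric in \<open>i\<close> and \<open>j\<close>, while this
  expression for it is not. Comparing the two expressions gives Schwarz's theorem.\<close>

lemma second_difference_mean_value:
  fixes f :: "real^'n::finite \<Rightarrow> real"
  assumes f: "has_partials f" "has_partials (partial i f)"
  obtains \<xi> \<eta> where "0 < \<xi>" "\<xi> < 1" "0 < \<eta>" "\<eta> < 1"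
    "f (x + e *\<^sub>R axis i 1 + e *\<^sub>R axis j 1) - f (x + e *\<^sub>R axis i 1)
       - f (x + e *\<^sub>R axis j 1) + f x
     = e\<^sup>2 * partial j (partial i f) (x + (\<xi> * e) *\<^sub>R axis i 1 + (\<eta> * e) *\<^sub>R axis j 1)"
proof -
  let ?a = "axis i (1::real) :: real^'n" and ?b = "axis j (1::real) :: real^'n"
  let ?g = "\<lambda>u. f (x + e *\<^sub>R ?b + (u * e) *\<^sub>R ?a) - f (x + (u * e) *\<^sub>R ?a)"
  have "(?g has_real_derivative partial i f (x + e *\<^sub>R ?b + (u * e) *\<^sub>R ?a) * e
      - partial i f (x + (u * e) *\<^sub>R ?a) * e) (at u)" for u
    by (intro DERIV_diff DERIV_chain2[OF DERIV_coordinate_line[OF f(1)]])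
       (auto intro!: derivative_eq_intros)
  then have "\<exists>\<xi>::real. 0 < \<xi> \<and> \<xi> < 1 \<and>
      ?g 1 - ?g 0 = (1 - 0) * (partial i f (x + e *\<^sub>R ?b + (\<xi> * e) *\<^sub>R ?a) * e
      - partial i f (x + (\<xi> * e) *\<^sub>R ?a) * e)"
    by (intro MVT2) auto
  then obtain \<xi> where \<xi>: "0 < \<xi>" "\<xi> < 1"
      "?g 1 - ?g 0 = e * (partial i f (x + (\<xi> * e) *\<^sub>R ?a + e *\<^sub>R ?b)
      - partial i f (x + (\<xi> * e) *\<^sub>R ?a))" by (auto simp: algebra_simps)
  obtain \<eta> where \<eta>: "0 < \<eta>" "\<eta> < 1"
      "partial i f (x + (\<xi> * e) *\<^sub>R ?a + e *\<^sub>R ?b) - partial i f (x + (\<xi> * e) *\<^sub>R ?a)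
       = e * partial j (partial i f) (x + (\<xi> * e) *\<^sub>R ?a + (\<eta> * e) *\<^sub>R ?b)"
    using partial_mean_value[OF f(2)] by blast
  show thesis
    using that[OF \<xi>(1,2) \<eta>(1,2)] \<xi>(3) unfolding \<eta>(3) by (simp add: algebra_simps power2_eq_square)
qed

text \<open>Schwarz's theorem: both mixed derivatives take a common value at two points as close to
  \<open>x\<close> as desired.\<close>

lemma partial_commute:
  fixes f :: "real^'n::finite \<Rightarrow> real"
  assumes f: "C_k (Suc (Suc 0)) f"
  shows "partial i (partial j f) = partial j (partial i f)"
proof
  fix x
  have p: "has_partials f" "has_partials (partial i f)" "has_partials (partial j f)"
    and c: "continuous_on UNIV (partial i (partial j f))" "continuous_on UNIV (partial j (partial i f))"
    using f unfolding C_k_Suc by auto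
  have "dist (partial i (partial j f) x) (partial j (partial i f) x) < e" if e: "0 < e" for e
  proof -
    have "0 < e / 2" using e by simp
    then obtain d1 d2 where d: "0 < d1" "0 < d2"
      and d1: "\<And>y. dist y x < d1 \<Longrightarrow> dist (partial i (partial j f) y) (partial i (partial j f) x) < e / 2"
      and d2: "\<And>y. dist y x < d2 \<Longrightarrow> dist (partial j (partial i f) y) (partial j (partial i f) x) < e / 2"
      using c unfolding continuous_on_iff by (metis UNIV_I)
    \<comment> \<open>points of the second difference with step \<open>t\<close> are within \<open>2 * t\<close> of \<open>x\<close>\<close>
    define t where "t = min d1 d2 / 3"
    have t: "0 < t" "2 * t < d1" "2 * t < d2" using d by (auto simp: t_def)
    have near: "dist (x + (\<xi> * t) *\<^sub>R axis a 1 + (\<eta> * t) *\<^sub>R axis b 1) x \<le> 2 * t"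
      if "0 < \<xi>" "\<xi> < 1" "0 < \<eta>" "\<eta> < 1" for \<xi> \<eta> and a b :: 'n
    proof -
      have "norm ((\<xi> * t) *\<^sub>R axis a (1::real) + (\<eta> * t) *\<^sub>R axis b 1 :: real^'n)
          \<le> \<xi> * t + \<eta> * t"
        using that t by (intro norm_triangle_le) (simp add: abs_mult)
      also have "\<dots> \<le> 1 * t + 1 * t" using that t by (intro add_mono mult_right_mono) auto
      finally show ?thesis by (simp add: dist_norm add.assoc)
    qed
    obtain \<xi> \<eta> where A: "0 < \<xi>" "\<xi> < 1" "0 < \<eta>" "\<eta> < 1"
      "f (x + t *\<^sub>R axis i 1 + t *\<^sub>R axis j 1) - f (x + t *\<^sub>R axis i 1)
       - f (x + t *\<^sub>R axis j 1) + f x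
       = t\<^sup>2 * partial j (partial i f) (x + (\<xi> * t) *\<^sub>R axis i 1 + (\<eta> * t) *\<^sub>R axis j 1)"
      by (rule second_difference_mean_value[OF p(1,2)])
    obtain \<xi>' \<eta>' where B: "0 < \<xi>'" "\<xi>' < 1" "0 < \<eta>'" "\<eta>' < 1"
      "f (x + t *\<^sub>R axis j 1 + t *\<^sub>R axis i 1) - f (x + t *\<^sub>R axis j 1)
       - f (x + t *\<^sub>R axis i 1) + f x
       = t\<^sup>2 * partial i (partial j f) (x + (\<xi>' * t) *\<^sub>R axis j 1 + (\<eta>' * t) *\<^sub>R axis i 1)"
      by (rule second_difference_mean_value[OF p(1,3)])
    have swap: "x + t *\<^sub>R axis j 1 + t *\<^sub>R axis i 1 = x + t *\<^sub>R axis i 1 + t *\<^sub>R axis j 1"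
      by (simp add: algebra_simps)
    have "t\<^sup>2 * partial j (partial i f) (x + (\<xi> * t) *\<^sub>R axis i 1 + (\<eta> * t) *\<^sub>R axis j 1)
        = t\<^sup>2 * partial i (partial j f) (x + (\<xi>' * t) *\<^sub>R axis j 1 + (\<eta>' * t) *\<^sub>R axis i 1)"
      unfolding A(5)[symmetric] B(5)[symmetric] swap by simp
    then have "partial j (partial i f) (x + (\<xi> * t) *\<^sub>R axis i 1 + (\<eta> * t) *\<^sub>R axis j 1)
        = partial i (partial j f) (x + (\<xi>' * t) *\<^sub>R axis j 1 + (\<eta>' * t) *\<^sub>R axis i 1)"
      using t by simp
    moreover have
      "dist (partial j (partial i f) (x + (\<xi> * t) *\<^sub>R axis i 1 + (\<eta> * t) *\<^sub>R axis j 1))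
        (partial j (partial i f) x) < e / 2"
      by (rule d2) (use near[OF A(1-4), of i j] t in linarith)
    moreover have
      "dist (partial i (partial j f) (x + (\<xi>' * t) *\<^sub>R axis j 1 + (\<eta>' * t) *\<^sub>R axis i 1))
        (partial i (partial j f) x) < e / 2"
      by (rule d1) (use near[OF B(1-4), of j i] t in linarith)
    ultimately show ?thesis unfolding dist_real_def by linarith
  qed
  then show "partial i (partial j f) x = partial j (partial i f) x"
    by (metis dist_pos_lt less_irrefl)
qed

lemma C_k_iterated_partial: "C_k (length is + m) f \<Longrightarrow> C_k m (foldr partial is f)"
proof (induction "is" arbitrary: m)
  case (Cons i "is")
  have "C_k (Suc m) (foldr partial is f)"
    by (rule Cons.IH) (use Cons.prems in \<open>simp del: C_k.simps\<close>)
  then show ?case unfolding C_k_Suc by simp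
qed simp

lemma partial_iterated_partial_commute:
  "C_k (Suc (length is)) f \<Longrightarrow> partial i (foldr partial is f) = foldr partial is (partial i f)"
proof (induction "is")
  case (Cons j "is")
  have "C_k (Suc (Suc 0)) (foldr partial is f)"
    using Cons.prems by (intro C_k_iterated_partial) (simp del: C_k.simps)
  then have "partial i (partial j (foldr partial is f)) = partial j (partial i (foldr partial is f))"
    by (rule partial_commute)
  then show ?case using Cons.IH C_k_pred[OF Cons.prems] by simp
qed simp

lemma iterated_partial_permute:
  "\<lbrakk>mset is = mset js; C_k (length is) f\<rbrakk> \<Longrightarrow> foldr partial is f = foldr partial js f"
proof (induction "is" arbitrary: js)
  case (Cons i "is")
  have "i \<in> set js" using mset_eq_setD[OF Cons.prems(1)] by auto
  then obtain as bs where js: "js = as @ i # bs" by (metis split_list)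
  have "mset is = mset (as @ bs)" using Cons.prems(1) by (simp add: js)
  then have IH: "foldr partial is f = foldr partial (as @ bs) f"
    and len: "length is = length as + length bs"
    using Cons.IH[of "as @ bs"] C_k_pred[of "length is" f] Cons.prems(2)
      mset_eq_length[of "is" "as @ bs"] by (simp_all del: C_k.simps)
  have "C_k (Suc (length as)) (foldr partial bs f)"
    using Cons.prems(2) len by (intro C_k_iterated_partial) (simp add: add.commute del: C_k.simps)
  from partial_iterated_partial_commute[OF this, of i] show ?case
    using IH by (simp add: js)
qed simp

section \<open>A recursive description of the norm balls\<close>

text \<open>A multi-index as a sequence of coordinates, in the order in which \<open>D\<close>
  differentiates (the last one first).\<close>

definition word_of :: "('n::finite \<Rightarrow> nat) \<Rightarrow> 'n list" where
  "word_of \<alpha> = concat (map (\<lambda>i. replicate (\<alpha> i) i) coords)"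

lemma distinct_coords: "distinct (coords :: 'n::finite list)"
  and set_coords: "set (coords :: 'n list) = UNIV"
proof -
  have "\<exists>is. distinct is \<and> set is = (UNIV :: 'n set)"
    using finite_distinct_list[of "UNIV :: 'n set"] by auto
  from someI_ex[OF this] show "distinct (coords :: 'n list)" "set (coords :: 'n list) = UNIV"
    by (auto simp: coords_def)
qed

lemma D_eq_word: "D \<alpha> f = foldr partial (word_of \<alpha>) f"
proof -
  have "foldr (\<lambda>i. partial i ^^ \<alpha> i) xs f = foldr partial (concat (map (\<lambda>i. replicate (\<alpha> i) i) xs)) f"
    for xs :: "'a list"
    by (induction xs) (simp_all add: foldr_replicate)
  then show ?thesis by (simp add: D_def word_of_def)
qed

lemma length_word_of: "length (word_of \<alpha>) = mi_order \<alpha>"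
  by (simp add: word_of_def mi_order_def length_concat comp_def distinct_coords set_coords
      sum_list_distinct_conv_sum_set)

lemma count_word_of: "count_list (word_of \<alpha>) i = \<alpha> i"
proof -
  have "count_list (concat (map (\<lambda>i. replicate (\<alpha> i) i) xs)) i = (if i \<in> set xs then \<alpha> i else 0)"
    if "distinct xs" for xs
    using that by (induction xs) (auto simp flip: count_mset)
  then show ?thesis by (simp add: word_of_def distinct_coords set_coords)
qed

text \<open>By Schwarz's theorem a sequence of coordinates matters only through its counts, and
  these form a multi-index.\<close>

lemma iterated_partial_eq_D:
  assumes "C_k (length is) f"
  shows "mi_order (count_list is) = length is" "D (count_list is) f = foldr partial is f"
proof -
  have m: "mset is = mset (word_of (count_list is))"
    by (simp add: multiset_eq_iff count_mset count_word_of)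
  then show "mi_order (count_list is) = length is"
    by (metis length_word_of mset_eq_length)
  show "D (count_list is) f = foldr partial is f"
    unfolding D_eq_word by (rule iterated_partial_permute[OF m assms, symmetric])
qed

text \<open>The ball of radius \<open>L\<close> in \<open>Cb_omega k \<omega>\<close>, described by
  recursion over first-order partial derivatives. Unlike the norm, this form has a direct induction
  on \<open>k\<close>: the partial derivatives of a member lie in the ball of the next lower
  order.\<close>

primrec deriv_ball :: "nat \<Rightarrow> (real \<Rightarrow> real) \<Rightarrow> real \<Rightarrow> (real^'n::finite \<Rightarrow> real) \<Rightarrow> bool" where
  "deriv_ball 0 \<omega> L f \<longleftrightarrow>
     (\<forall>x. \<bar>f x\<bar> \<le> L) \<and> (\<forall>x y. x \<noteq> y \<longrightarrow> \<bar>f x - f y\<bar> \<le> L * \<omega> (norm (x - y)))"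
| "deriv_ball (Suc k) \<omega> L f \<longleftrightarrow>
     (\<forall>x. \<bar>f x\<bar> \<le> L) \<and> has_partials f \<and> (\<forall>i. deriv_ball k \<omega> L (partial i f))"

lemma deriv_ball_bound: "deriv_ball k \<omega> L f \<Longrightarrow> \<bar>f x\<bar> \<le> L"
  by (cases k) auto

lemma deriv_ball_nonneg: "deriv_ball k \<omega> L f \<Longrightarrow> 0 \<le> L"
  using deriv_ball_bound[of k \<omega> L f 0] by linarith

lemma continuous_if_modulus:
  fixes f :: "'a::real_normed_vector \<Rightarrow> real"
  assumes \<omega>: "(\<omega> \<longlongrightarrow> 0) (at_right 0)"
    and f: "\<And>x y. x \<noteq> y \<Longrightarrow> \<bar>f x - f y\<bar> \<le> L * \<omega> (norm (x - y))"
  shows "continuous_on UNIV f"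
proof -
  have "(f \<longlongrightarrow> f x) (at x)" for x
  proof -
    have "filterlim (\<lambda>y. norm (y - x)) (at_right 0) (at x)"
      unfolding filterlim_at
    proof
      show "\<forall>\<^sub>F y in at x. norm (y - x) \<in> {0<..} \<and> norm (y - x) \<noteq> 0"
        by (simp add: eventually_at_filter)
      show "((\<lambda>y. norm (y - x)) \<longlongrightarrow> 0) (at x)"
        by (auto intro!: tendsto_eq_intros)
    qed
    then have "((\<lambda>y. L * \<omega> (norm (y - x))) \<longlongrightarrow> L * 0) (at x)"
      by (intro tendsto_intros filterlim_compose[OF \<omega>])
    then have "((\<lambda>y. L * \<omega> (norm (y - x))) \<longlongrightarrow> 0) (at x)" by simp
    moreover have "\<forall>\<^sub>F y in at x. norm (f y - f x) \<le> L * \<omega> (norm (y - x))"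
      unfolding eventually_at_filter using f by (auto intro!: always_eventually)
    ultimately have "((\<lambda>y. f y - f x) \<longlongrightarrow> 0) (at x)" by (rule Lim_null_comparison[rotated])
    then show ?thesis by (simp add: LIM_zero_iff)
  qed
  then show ?thesis by (simp add: continuous_on_def)
qed

lemma deriv_ball_C_k:
  assumes "(\<omega> \<longlongrightarrow> 0) (at_right 0)"
  shows "deriv_ball k \<omega> L f \<Longrightarrow> C_k k f"
proof (induction k arbitrary: f)
  case 0
  then show ?case using continuous_if_modulus[OF assms, of f L] by simp
next
  case (Suc k)
  then show ?case unfolding C_k_Suc by simp
qed

text \<open>The recursion strips the innermost derivative, hence words are split at their last
  letter.\<close>

lemma deriv_ball_iff_words:
  "C_k k f \<Longrightarrow> deriv_ball k \<omega> L f \<longleftrightarrow>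
     (\<forall>is x. length is \<le> k \<longrightarrow> \<bar>foldr partial is f x\<bar> \<le> L) \<and>
     (\<forall>is x y. length is = k \<longrightarrow> x \<noteq> y \<longrightarrow>
        \<bar>foldr partial is f x - foldr partial is f y\<bar> \<le> L * \<omega> (norm (x - y)))"
proof (induction k arbitrary: f)
  case 0
  then show ?case by auto
next
  case (Suc k)
  have C: "has_partials f" "\<And>i. C_k k (partial i f)"
    using Suc.prems unfolding C_k_Suc by auto
  have split: "(\<forall>is. length is \<le> Suc k \<longrightarrow> P is) \<longleftrightarrow> P [] \<and> (\<forall>is i. length is \<le> k \<longrightarrow> P (is @ [i]))"
    "(\<forall>is. length is = Suc k \<longrightarrow> P is) \<longleftrightarrow> (\<forall>is i. length is = k \<longrightarrow> P (is @ [i]))"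
    for P :: "'a list \<Rightarrow> bool"
  proof -
    have snoc: "(\<forall>is. Q is) \<longleftrightarrow> Q [] \<and> (\<forall>is i. Q (is @ [i]))" for Q :: "'a list \<Rightarrow> bool"
    proof safe
      fix "is" assume "Q []" "\<forall>is i. Q (is @ [i])"
      then show "Q is" by (cases "is" rule: rev_cases) auto
    qed auto
    show "(\<forall>is. length is \<le> Suc k \<longrightarrow> P is) \<longleftrightarrow> P [] \<and> (\<forall>is i. length is \<le> k \<longrightarrow> P (is @ [i]))"
      "(\<forall>is. length is = Suc k \<longrightarrow> P is) \<longleftrightarrow> (\<forall>is i. length is = k \<longrightarrow> P (is @ [i]))"
      by (subst snoc, simp)+
  qed
  have "deriv_ball (Suc k) \<omega> L f \<longleftrightarrow> (\<forall>x. \<bar>f x\<bar> \<le> L) \<and> (\<forall>i.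
     (\<forall>is x. length is \<le> k \<longrightarrow> \<bar>foldr partial is (partial i f) x\<bar> \<le> L) \<and>
     (\<forall>is x y. length is = k \<longrightarrow> x \<noteq> y \<longrightarrow>
        \<bar>foldr partial is (partial i f) x - foldr partial is (partial i f) y\<bar> \<le> L * \<omega> (norm (x - y))))"
    using Suc.IH[OF C(2)] C(1) by simp
  also have "\<dots> \<longleftrightarrow> (\<forall>is. length is \<le> Suc k \<longrightarrow> (\<forall>x. \<bar>foldr partial is f x\<bar> \<le> L)) \<and>
     (\<forall>is. length is = Suc k \<longrightarrow> (\<forall>x y. x \<noteq> y \<longrightarrow>
        \<bar>foldr partial is f x - foldr partial is f y\<bar> \<le> L * \<omega> (norm (x - y))))"
    unfolding split by (simp add: foldr_append) blast
  finally show ?case by blast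
qed

lemma deriv_ball_iff_D:
  assumes "C_k k f"
  shows "deriv_ball k \<omega> L f \<longleftrightarrow>
     (\<forall>\<alpha> x. mi_order \<alpha> \<le> k \<longrightarrow> \<bar>D \<alpha> f x\<bar> \<le> L) \<and>
     (\<forall>\<alpha> x y. mi_order \<alpha> = k \<longrightarrow> x \<noteq> y \<longrightarrow>
        \<bar>D \<alpha> f x - D \<alpha> f y\<bar> \<le> L * \<omega> (norm (x - y)))"
proof -
  have mono: "C_k m f" if "m \<le> k" for m
    using that assms by (induction rule: inc_induct) (use C_k_pred in blast)+
  have words: "(\<forall>is. length is \<le> k \<longrightarrow> P (length is) (foldr partial is f)) \<longleftrightarrow>
      (\<forall>\<alpha>. mi_order \<alpha> \<le> k \<longrightarrow> P (mi_order \<alpha>) (D \<alpha> f))" (is "?W \<longleftrightarrow> ?M") for P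
  proof
    assume W: ?W
    show ?M
    proof (intro allI impI)
      fix \<alpha> :: "'a \<Rightarrow> nat" assume "mi_order \<alpha> \<le> k"
      then show "P (mi_order \<alpha>) (D \<alpha> f)"
        using W[rule_format, of "word_of \<alpha>"] by (simp add: length_word_of D_eq_word)
    qed
  next
    assume M: ?M
    show ?W
    proof (intro allI impI)
      fix "is" :: "'a list" assume "length is \<le> k"
      then show "P (length is) (foldr partial is f)"
        using M[rule_format, of "count_list is"] iterated_partial_eq_D[OF mono, of "is"] by simp
    qed
  qed
  have top: "(\<forall>is. length is = k \<longrightarrow> P (foldr partial is f)) \<longleftrightarrow> (\<forall>\<alpha>. mi_order \<alpha> = k \<longrightarrow> P (D \<alpha> f))" for P
    using words[of "\<lambda>l g. l = k \<longrightarrow> P g"] by (metis order_refl)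
  show ?thesis
    unfolding deriv_ball_iff_words[OF assms]
    using words[of "\<lambda>_ g. \<forall>x. \<bar>g x\<bar> \<le> L"]
      top[of "\<lambda>g. \<forall>x y. x \<noteq> y \<longrightarrow> \<bar>g x - g y\<bar> \<le> L * \<omega> (norm (x - y))"] by simp
qed

lemma finite_multi_indices: "finite {\<alpha> :: 'n::finite \<Rightarrow> nat. mi_order \<alpha> \<le> k}"
proof (rule finite_subset)
  have "\<alpha> i \<le> mi_order \<alpha>" for \<alpha> :: "'n \<Rightarrow> nat" and i
    unfolding mi_order_def by (rule member_le_sum) auto
  then show "{\<alpha> :: 'n \<Rightarrow> nat. mi_order \<alpha> \<le> k} \<subseteq> Pi\<^sub>E UNIV (\<lambda>_. {..k})"
    using order_trans by fastforce
  show "finite (Pi\<^sub>E UNIV (\<lambda>_::'n. {..k}))" by (intro finite_PiE) auto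
qed

lemma ex_multi_index: "\<exists>\<alpha> :: 'n::finite \<Rightarrow> nat. mi_order \<alpha> = k"
proof
  show "mi_order (\<lambda>i :: 'n. if i = undefined then k else 0) = k"
    by (simp add: mi_order_def)
qed

lemma hoelder_quotients_nonempty: "hoelder_quotients \<omega> (g :: real^'n::finite \<Rightarrow> real) \<noteq> {}"
proof -
  have "(0 :: real^'n) \<noteq> axis undefined 1" by (metis axis_eq_0_iff zero_neq_one)
  then show ?thesis unfolding hoelder_quotients_def by blast
qed

lemma hoelder_quotients_le_iff:
  assumes "\<And>t. 0 < t \<Longrightarrow> 0 < \<omega> t"
  shows "(\<forall>q\<in>hoelder_quotients \<omega> g. q \<le> L) \<longleftrightarrow>
    (\<forall>x y. x \<noteq> y \<longrightarrow> \<bar>g x - g y\<bar> \<le> L * \<omega> (norm (x - y)))"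
proof -
  have "\<bar>g x - g y\<bar> / \<omega> (norm (x - y)) \<le> L \<longleftrightarrow> \<bar>g x - g y\<bar> \<le> L * \<omega> (norm (x - y))"
    if "x \<noteq> y" for x y
    using assms[of "norm (x - y)"] that by (simp add: pos_divide_le_eq)
  then show ?thesis unfolding hoelder_quotients_def by blast
qed

text \<open>All properties of the norm are read off from this equivalence: the norm of
  \<open>f\<close> is the least radius of a ball containing \<open>f\<close>. Schwarz's theorem
  enters from left to right: the norm controls only the derivatives taken in the order of
  \<open>coords\<close>, whereas \<open>deriv_ball\<close> bounds those in every order.\<close>

lemma Cb_omega_ball_iff:
  assumes "modulus_of_continuity \<omega>"
  shows "f \<in> Cb_omega k \<omega> \<and> Cb_omega_norm k \<omega> f \<le> L \<longleftrightarrow> deriv_ball k \<omega> L f"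
proof -
  have pos: "\<And>t. 0 < t \<Longrightarrow> 0 < \<omega> t" and lim: "(\<omega> \<longlongrightarrow> 0) (at_right 0)"
    using assms by (auto simp: modulus_of_continuity_def)
  define A where "A \<longleftrightarrow> (\<forall>\<alpha>. mi_order \<alpha> \<le> k \<longrightarrow> bdd_above (range (\<lambda>x. \<bar>D \<alpha> f x\<bar>))) \<and>
     (\<forall>\<alpha>. mi_order \<alpha> = k \<longrightarrow> bdd_above (hoelder_quotients \<omega> (D \<alpha> f)))"
  have fin: "finite {\<alpha> :: 'a \<Rightarrow> nat. mi_order \<alpha> \<le> k}" "finite {\<alpha> :: 'a \<Rightarrow> nat. mi_order \<alpha> = k}"
    using finite_multi_indices[of k] by (auto elim: rev_finite_subset)
  have ne: "{\<alpha> :: 'a \<Rightarrow> nat. mi_order \<alpha> \<le> k} \<noteq> {}" "{\<alpha> :: 'a \<Rightarrow> nat. mi_order \<alpha> = k} \<noteq> {}"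
    using ex_multi_index[of k, where ?'n = 'a] by auto
  define P where "P \<longleftrightarrow> (\<forall>\<alpha>. mi_order \<alpha> \<le> k \<longrightarrow> (\<forall>x. \<bar>D \<alpha> f x\<bar> \<le> L)) \<and>
      (\<forall>\<alpha>. mi_order \<alpha> = k \<longrightarrow> (\<forall>q\<in>hoelder_quotients \<omega> (D \<alpha> f). q \<le> L))"
  have norm_le: "Cb_omega_norm k \<omega> f \<le> L \<longleftrightarrow> P" if A
  proof -
    have "(SUP x. \<bar>D \<alpha> f x\<bar>) \<le> L \<longleftrightarrow> (\<forall>x. \<bar>D \<alpha> f x\<bar> \<le> L)" if "mi_order \<alpha> \<le> k" for \<alpha>
      using cSUP_le_iff[of UNIV "\<lambda>x. \<bar>D \<alpha> f x\<bar>" L] \<open>A\<close> that by (simp add: A_def)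
    moreover have "Sup (hoelder_quotients \<omega> (D \<alpha> f)) \<le> L \<longleftrightarrow>
        (\<forall>q\<in>hoelder_quotients \<omega> (D \<alpha> f). q \<le> L)" if "mi_order \<alpha> = k" for \<alpha>
      using \<open>A\<close> that by (intro cSup_le_iff hoelder_quotients_nonempty) (simp add: A_def)
    ultimately show ?thesis
      unfolding Cb_omega_norm_def Cb_norm_def Cb_omega_seminorm_def P_def
      using fin ne by simp
  qed
  have bdd: A if P
    using that unfolding A_def P_def by (auto intro!: bdd_aboveI)
  have "f \<in> Cb_omega k \<omega> \<longleftrightarrow> C_k k f \<and> A"
    by (simp add: Cb_omega_def A_def)
  then have "f \<in> Cb_omega k \<omega> \<and> Cb_omega_norm k \<omega> f \<le> L \<longleftrightarrow> C_k k f \<and> P"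
    using norm_le bdd by blast
  also have "\<dots> \<longleftrightarrow> deriv_ball k \<omega> L f"
  proof -
    have "P \<longleftrightarrow> deriv_ball k \<omega> L f" if "C_k k f"
      unfolding deriv_ball_iff_D[OF that] P_def
      by (simp add: hoelder_quotients_le_iff[of \<omega>] pos)
    then show ?thesis using deriv_ball_C_k[OF lim, of k L f] by blast
  qed
  finally show ?thesis .
qed

lemma has_partials_add:
  assumes "has_partials f" "has_partials g"
  shows "has_partials (f + g)" "partial i (f + g) = partial i f + partial i g"
proof -
  have "((\<lambda>t. f (x + t *\<^sub>R axis i 1) + g (x + t *\<^sub>R axis i 1)) has_real_derivative
      partial i f x + partial i g x) (at 0)" for i x
    using DERIV_add[OF DERIV_coordinate_line[OF assms(1), of x i 0]
        DERIV_coordinate_line[OF assms(2), of x i 0]] by simp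
  note * = this
  show "has_partials (f + g)"
    unfolding has_partials_def real_differentiable_def using * by auto
  show "partial i (f + g) = partial i f + partial i g"
    using DERIV_imp_deriv[OF *] by (intro ext) (simp add: partial_def[of i "f + g"])
qed

lemma has_partials_scale:
  assumes "has_partials f"
  shows "has_partials (c *\<^sub>R f)" "partial i (c *\<^sub>R f) = c *\<^sub>R partial i f"
proof -
  have "((\<lambda>t. c * f (x + t *\<^sub>R axis i 1)) has_real_derivative c * partial i f x) (at 0)" for i x
    using DERIV_cmult[OF DERIV_coordinate_line[OF assms, of x i 0]] by simp
  note * = this
  show "has_partials (c *\<^sub>R f)"
    unfolding has_partials_def real_differentiable_def using * by (auto simp: scaleR_apply)
  show "partial i (c *\<^sub>R f) = c *\<^sub>R partial i f"
    using DERIV_imp_deriv[OF *]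
    by (intro ext) (simp add: partial_def[of i "c *\<^sub>R f"] scaleR_apply)
qed

lemma deriv_ball_zero: "deriv_ball k \<omega> 0 0"
proof (induction k)
  case (Suc k)
  have "partial i (0 :: real^'a \<Rightarrow> real) = 0" for i
    by (intro ext) (simp add: partial_def zero_fun_def)
  then show ?case using Suc by (simp add: has_partials_def zero_fun_def)
qed simp

lemma deriv_ball_add:
  "\<lbrakk>deriv_ball k \<omega> L f; deriv_ball k \<omega> M g\<rbrakk> \<Longrightarrow> deriv_ball k \<omega> (L + M) (f + g)"
proof (induction k arbitrary: f g)
  case 0
  have "\<bar>f x + g x\<bar> \<le> L + M" for x
    using deriv_ball_bound[OF 0(1), of x] deriv_ball_bound[OF 0(2), of x] by linarith
  moreover have "\<bar>f x + g x - (f y + g y)\<bar> \<le> (L + M) * \<omega> (norm (x - y))" if "x \<noteq> y" for x y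
  proof -
    have "\<bar>f x - f y\<bar> \<le> L * \<omega> (norm (x - y))" "\<bar>g x - g y\<bar> \<le> M * \<omega> (norm (x - y))"
      using 0 that by auto
    then show ?thesis unfolding distrib_right by linarith
  qed
  ultimately show ?case by simp
next
  case (Suc k)
  have "\<bar>f x + g x\<bar> \<le> L + M" for x
    using deriv_ball_bound[OF Suc.prems(1), of x] deriv_ball_bound[OF Suc.prems(2), of x] by linarith
  moreover have "has_partials f" "has_partials g"
    using Suc.prems by simp_all
  moreover have "deriv_ball k \<omega> (L + M) (partial i f + partial i g)" for i
    using Suc.prems by (intro Suc.IH) simp_all
  ultimately show ?case
    unfolding deriv_ball.simps has_partials_add(2)[OF \<open>has_partials f\<close> \<open>has_partials g\<close>]
    using has_partials_add(1) by auto
qed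

lemma deriv_ball_scale:
  "deriv_ball k \<omega> L f \<Longrightarrow> deriv_ball k \<omega> (\<bar>c\<bar> * L) (c *\<^sub>R f)"
proof (induction k arbitrary: f)
  case 0
  have "\<bar>c * f x - c * f y\<bar> \<le> \<bar>c\<bar> * (L * \<omega> (norm (x - y)))" if "x \<noteq> y" for x y
    using 0 that unfolding right_diff_distrib[symmetric] abs_mult
    by (intro mult_left_mono) auto
  then show ?case using 0 by (simp add: scaleR_fun_def abs_mult mult_left_mono mult.assoc)
next
  case (Suc k)
  then show ?case
    by (simp add: has_partials_scale) (simp add: scaleR_fun_def abs_mult mult_left_mono)
qed

section \<open>Pointwise limits of differentiable functions\<close>

text \<open>A common modulus of continuity for the whole ball, whatever \<open>k\<close> is: for
  \<open>k = 0\<close> the first summand is the defining condition, and for larger \<open>k\<close>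
  the bounded partial derivatives give a Lipschitz constant, which accounts for the second.\<close>

lemma deriv_ball_modulus:
  fixes f :: "real^'n::finite \<Rightarrow> real"
  assumes pos: "\<And>t. 0 < t \<Longrightarrow> 0 < \<omega> t" and f: "deriv_ball k \<omega> L f" and xy: "x \<noteq> y"
  shows "\<bar>f x - f y\<bar> \<le> L * (\<omega> (norm (x - y)) + CARD('n) * norm (x - y))"
proof -
  have L: "0 \<le> L" using f by (rule deriv_ball_nonneg)
  show ?thesis
  proof (cases k)
    case 0
    then have "\<bar>f x - f y\<bar> \<le> L * \<omega> (norm (x - y))" using f xy by simp
    also have "\<dots> \<le> L * (\<omega> (norm (x - y)) + CARD('n) * norm (x - y))"
      using L by (intro mult_left_mono) auto
    finally show ?thesis .
  next
    case (Suc l)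
    have "\<bar>f x - f y\<bar> \<le> L * (\<Sum>j\<in>UNIV. \<bar>x $ j - y $ j\<bar>)"
      using f unfolding Suc
      by (intro coordinatewise_mean_value_bound) (auto intro: deriv_ball_bound)
    also have "\<dots> \<le> L * (\<Sum>j\<in>(UNIV :: 'n set). norm (x - y))"
      using L component_le_norm_cart[of "x - y"] by (intro mult_left_mono sum_mono) auto
    also have "\<dots> \<le> L * (\<omega> (norm (x - y)) + CARD('n) * norm (x - y))"
      using L pos[of "norm (x - y)"] xy by (intro mult_left_mono) auto
    finally show ?thesis .
  qed
qed

lemma difference_quotient_partial:
  fixes f :: "real^'n::finite \<Rightarrow> real"
  assumes f: "has_partials f"
    and mod: "\<And>x y. x \<noteq> y \<Longrightarrow> \<bar>partial i f x - partial i f y\<bar> \<le> \<eta> (norm (x - y))"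
    and mono: "mono_on {0<..} \<eta>" and t: "t \<noteq> 0"
  shows "\<bar>(f (x + t *\<^sub>R axis i 1) - f x) / t - partial i f x\<bar> \<le> \<eta> \<bar>t\<bar>"
proof -
  obtain \<theta> where \<theta>: "0 < \<theta>" "\<theta> < 1"
    "f (x + t *\<^sub>R axis i 1) - f x = t * partial i f (x + (\<theta> * t) *\<^sub>R axis i 1)"
    using partial_mean_value[OF f] by blast
  have n: "norm (x + (\<theta> * t) *\<^sub>R axis i 1 - x) = \<theta> * \<bar>t\<bar>"
    using \<theta> by (simp add: abs_mult)
  have ne: "x + (\<theta> * t) *\<^sub>R axis i 1 \<noteq> x" using \<theta> t by (simp add: axis_eq_0_iff)
  have "\<bar>partial i f (x + (\<theta> * t) *\<^sub>R axis i 1) - partial i f x\<bar> \<le> \<eta> (\<theta> * \<bar>t\<bar>)"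
    using mod[OF ne] unfolding n .
  also have "\<dots> \<le> \<eta> \<bar>t\<bar>"
  proof (rule mono_onD[OF mono])
    show "\<theta> * \<bar>t\<bar> \<le> \<bar>t\<bar>" using mult_right_mono[of \<theta> 1 "\<bar>t\<bar>"] \<theta> by simp
  qed (use \<theta> t in auto)
  finally show ?thesis using t by (simp add: \<theta>(3))
qed

text \<open>Why derivatives pass to pointwise limits. By \<open>difference_quotient_partial\<close>
  the difference quotients of all \<open>u m\<close> are within \<open>\<eta> \<bar>t\<bar>\<close>
  of the derivative, uniformly in \<open>m\<close>. Hence two difference quotients of \<open>u
  m\<close> differ by at most \<open>\<eta> \<bar>s\<bar> + \<eta> \<bar>t\<bar>\<close>, a bound
  that survives the pointwise limit; so those of \<open>f\<close> converge, at the same rate. The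
  derivatives of \<open>u m\<close> and of \<open>f\<close> are then compared through the difference
  quotients at one small step. Filters instead of sequences are used because pointwise convergence
  on an uncountable set is not metrisable.\<close>

lemma partial_pointwise_limit:
  fixes f :: "real^'n::finite \<Rightarrow> real" and u :: "'b \<Rightarrow> real^'n \<Rightarrow> real"
  assumes F: "F \<noteq> bot"
    and u: "\<forall>\<^sub>F m in F. has_partials (u m) \<and>
      (\<forall>x y. x \<noteq> y \<longrightarrow> \<bar>partial i (u m) x - partial i (u m) y\<bar> \<le> \<eta> (norm (x - y)))"
    and mono: "mono_on {0<..} \<eta>" and \<eta>: "(\<eta> \<longlongrightarrow> 0) (at_right 0)"
    and lim: "\<And>x. ((\<lambda>m. u m x) \<longlongrightarrow> f x) F"
  shows "(\<lambda>t. f (x + t *\<^sub>R axis i 1)) differentiable (at 0)"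
    and "((\<lambda>m. partial i (u m) x) \<longlongrightarrow> partial i f x) F"
proof -
  define q where "q g t = (g (x + t *\<^sub>R axis i 1) - g x) / t" for g :: "real^'n \<Rightarrow> real" and t
  have q_lim: "((\<lambda>m. q (u m) t) \<longlongrightarrow> q f t) F" for t
    unfolding q_def divide_inverse by (intro tendsto_intros lim)
  have close: "\<forall>\<^sub>F m in F. \<bar>q (u m) t - partial i (u m) x\<bar> \<le> \<eta> \<bar>t\<bar>" if "t \<noteq> 0" for t
    using u
  proof eventually_elim
    case (elim m)
    then show ?case
      unfolding q_def by (intro difference_quotient_partial mono that) auto
  qed
  have cauchy: "\<bar>q f s - q f t\<bar> \<le> \<eta> \<bar>s\<bar> + \<eta> \<bar>t\<bar>" if "s \<noteq> 0" "t \<noteq> 0" for s t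
  proof (rule tendsto_upperbound[OF _ _ F])
    show "((\<lambda>m. \<bar>q (u m) s - q (u m) t\<bar>) \<longlongrightarrow> \<bar>q f s - q f t\<bar>) F"
      by (intro tendsto_intros q_lim)
    show "\<forall>\<^sub>F m in F. \<bar>q (u m) s - q (u m) t\<bar> \<le> \<eta> \<bar>s\<bar> + \<eta> \<bar>t\<bar>"
      using close[OF that(1)] close[OF that(2)] by eventually_elim linarith
  qed
  \<comment> \<open>a sequence of steps suffices to find the limit, by completeness of the reals\<close>
  define s where "s n = 1 / real (Suc n)" for n
  have s_pos: "0 < s n" for n by (simp add: s_def)
  have "s \<longlonglongrightarrow> 0" unfolding s_def by (rule LIMSEQ_Suc[OF lim_1_over_n])
  then have "filterlim s (at_right 0) sequentially"
    unfolding filterlim_at using s_pos by (auto simp: less_imp_neq[symmetric] intro: always_eventually)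
  then have \<eta>_s: "(\<lambda>n. \<eta> (s n)) \<longlonglongrightarrow> 0" by (rule filterlim_compose[OF \<eta>])
  have "Cauchy (\<lambda>n. q f (s n))"
  proof (rule CauchyI)
    fix e :: real assume e: "0 < e"
    have "0 < e / 2" using e by simp
    then have "\<forall>\<^sub>F n in sequentially. \<eta> (s n) < e / 2" using \<eta>_s by (rule order_tendstoD(2)[rotated])
    then obtain M where M: "\<And>n. M \<le> n \<Longrightarrow> \<eta> (s n) < e / 2" by (auto simp: eventually_sequentially)
    show "\<exists>M. \<forall>m\<ge>M. \<forall>n\<ge>M. norm (q f (s m) - q f (s n)) < e"
    proof (intro exI[of _ M] allI impI)
      fix m n assume "M \<le> m" "M \<le> n"
      then show "norm (q f (s m) - q f (s n)) < e"
        using cauchy[of "s m" "s n"] M[of m] M[of n] s_pos[of m] s_pos[of n] by simp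
    qed
  qed
  then obtain g where g: "(\<lambda>n. q f (s n)) \<longlonglongrightarrow> g"
    using Cauchy_convergent convergent_def by blast
  have q_g: "\<bar>q f t - g\<bar> \<le> \<eta> \<bar>t\<bar>" if t: "t \<noteq> 0" for t
  proof (rule LIMSEQ_le)
    show "(\<lambda>n. \<bar>q f t - q f (s n)\<bar>) \<longlonglongrightarrow> \<bar>q f t - g\<bar>"
      by (intro tendsto_intros g)
    have "(\<lambda>n. \<eta> \<bar>t\<bar> + \<eta> (s n)) \<longlonglongrightarrow> \<eta> \<bar>t\<bar> + 0" by (intro tendsto_intros \<eta>_s)
    then show "(\<lambda>n. \<eta> \<bar>t\<bar> + \<eta> (s n)) \<longlonglongrightarrow> \<eta> \<bar>t\<bar>" by simp
    have "\<bar>q f t - q f (s n)\<bar> \<le> \<eta> \<bar>t\<bar> + \<eta> (s n)" for n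
      using cauchy[OF t, of "s n"] s_pos[of n] by simp
    then show "\<exists>N. \<forall>n\<ge>N. \<bar>q f t - q f (s n)\<bar> \<le> \<eta> \<bar>t\<bar> + \<eta> (s n)" by blast
  qed
  have abs_at: "filterlim abs (at_right 0) (at (0::real))"
    unfolding filterlim_at
  proof
    show "\<forall>\<^sub>F t::real in at 0. \<bar>t\<bar> \<in> {0<..} \<and> \<bar>t\<bar> \<noteq> 0" by (simp add: eventually_at_filter)
    show "(abs \<longlongrightarrow> 0) (at (0::real))" by (auto intro!: tendsto_eq_intros)
  qed
  have "(q f \<longlongrightarrow> g) (at 0)"
  proof -
    have "((\<lambda>t. q f t - g) \<longlongrightarrow> 0) (at 0)"
    proof (rule Lim_null_comparison)
      show "\<forall>\<^sub>F t in at 0. norm (q f t - g) \<le> \<eta> \<bar>t\<bar>"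
        unfolding eventually_at_filter using q_g by (auto intro!: always_eventually)
      show "((\<lambda>t. \<eta> \<bar>t\<bar>) \<longlongrightarrow> 0) (at 0)" by (rule filterlim_compose[OF \<eta> abs_at])
    qed
    then show ?thesis by (simp add: LIM_zero_iff)
  qed
  then have deriv: "((\<lambda>t. f (x + t *\<^sub>R axis i 1)) has_real_derivative g) (at 0)"
    unfolding DERIV_def q_def[abs_def] by simp
  then show "(\<lambda>t. f (x + t *\<^sub>R axis i 1)) differentiable (at 0)"
    by (auto simp: real_differentiable_def)
  have "((\<lambda>m. partial i (u m) x) \<longlongrightarrow> g) F"
  proof (rule tendstoI)
    fix e :: real assume e: "0 < e"
    have "0 < e / 3" using e by simp
    then have "\<forall>\<^sub>F n in sequentially. \<eta> (s n) < e / 3" using \<eta>_s by (rule order_tendstoD(2)[rotated])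
    then obtain n where n: "\<eta> (s n) < e / 3" by (auto simp: eventually_sequentially)
    have sn: "s n \<noteq> 0" using s_pos[of n] by simp
    have "\<forall>\<^sub>F m in F. dist (q (u m) (s n)) (q f (s n)) < e / 3"
      by (rule tendstoD[OF q_lim]) (use e in simp)
    with close[OF sn] show "\<forall>\<^sub>F m in F. dist (partial i (u m) x) g < e"
    proof eventually_elim
      case (elim m)
      then show ?case
        using q_g[OF sn] n s_pos[of n] unfolding dist_real_def abs_of_pos[OF s_pos] by linarith
    qed
  qed
  moreover have "partial i f x = g"
    using DERIV_imp_deriv[OF deriv] by (simp add: partial_def)
  ultimately show "((\<lambda>m. partial i (u m) x) \<longlongrightarrow> partial i f x) F" by simp
qed

text \<open>The induction hypothesis applies to the partial derivatives: they converge pointwise by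
  \<open>partial_pointwise_limit\<close>, whose modulus comes from
  \<open>deriv_ball_modulus\<close>.\<close>

lemma deriv_ball_pointwise_limit:
  fixes f :: "real^'n::finite \<Rightarrow> real" and u :: "'b \<Rightarrow> real^'n \<Rightarrow> real"
  assumes \<omega>: "modulus_of_continuity \<omega>" and F: "F \<noteq> bot"
  shows "\<lbrakk>\<forall>\<^sub>F m in F. deriv_ball k \<omega> L (u m); \<And>x. ((\<lambda>m. u m x) \<longlongrightarrow> f x) F\<rbrakk>
    \<Longrightarrow> deriv_ball k \<omega> L f"
proof (induction k arbitrary: u f)
  case 0
  have "\<bar>f x\<bar> \<le> L" for x
    by (rule tendsto_upperbound[OF tendsto_rabs[OF 0(2)] _ F])
       (use 0(1) in \<open>auto elim: eventually_mono\<close>)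
  moreover have "\<bar>f x - f y\<bar> \<le> L * \<omega> (norm (x - y))" if "x \<noteq> y" for x y
    by (rule tendsto_upperbound[OF tendsto_rabs[OF tendsto_diff[OF 0(2) 0(2)]] _ F])
       (use 0(1) that in \<open>auto elim: eventually_mono\<close>)
  ultimately show ?case by simp
next
  case (Suc k)
  have pos: "\<And>t. 0 < t \<Longrightarrow> 0 < \<omega> t" and mono: "mono_on {0<..} \<omega>"
    and lim: "(\<omega> \<longlongrightarrow> 0) (at_right 0)"
    using \<omega> by (auto simp: modulus_of_continuity_def)
  define \<eta> where "\<eta> t = L * (\<omega> t + real CARD('n) * t)" for t :: real
  have "\<exists>m. deriv_ball (Suc k) \<omega> L (u m)"
    using eventually_happens'[OF F Suc.prems(1)] .
  then have L: "0 \<le> L" using deriv_ball_nonneg by blast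
  have "mono_on {0<..} \<eta>"
    unfolding \<eta>_def using L mono by (auto simp: mono_on_def intro!: mult_left_mono add_mono)
  moreover have "(\<eta> \<longlongrightarrow> L * (0 + real CARD('n) * 0)) (at_right 0)"
    unfolding \<eta>_def by (intro tendsto_intros lim)
  then have "(\<eta> \<longlongrightarrow> 0) (at_right 0)" by simp
  moreover have "\<forall>\<^sub>F m in F. has_partials (u m) \<and>
      (\<forall>x y. x \<noteq> y \<longrightarrow> \<bar>partial i (u m) x - partial i (u m) y\<bar> \<le> \<eta> (norm (x - y)))" for i
    using Suc.prems(1)
  proof eventually_elim
    case (elim m)
    then show ?case using deriv_ball_modulus[of \<omega> k L "partial i (u m)"] pos by (auto simp: \<eta>_def)
  qed
  ultimately have diff: "(\<lambda>t. f (x + t *\<^sub>R axis i 1)) differentiable (at 0)"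
    and partial_lim: "((\<lambda>m. partial i (u m) x) \<longlongrightarrow> partial i f x) F" for i x
    using partial_pointwise_limit[OF F, where u = u and f = f] Suc.prems(2) by blast+
  have "deriv_ball k \<omega> L (partial i f)" for i
  proof (rule Suc.IH[OF _ partial_lim])
    show "\<forall>\<^sub>F m in F. deriv_ball k \<omega> L (partial i (u m))"
      using Suc.prems(1) by eventually_elim auto
  qed
  moreover have "\<bar>f x\<bar> \<le> L" for x
    by (rule tendsto_upperbound[OF tendsto_rabs[OF Suc.prems(2)] _ F])
       (use Suc.prems(1) in \<open>auto elim: eventually_mono\<close>)
  ultimately show ?case using diff by (simp add: has_partials_def)
qed

lemma closed_deriv_ball:
  assumes "modulus_of_continuity \<omega>"
  shows "closed {f :: real^'n::finite \<Rightarrow> real. deriv_ball k \<omega> L f}"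
  unfolding closed_limpt
proof (intro allI impI)
  fix f :: "real^'n \<Rightarrow> real" assume "f islimpt {f. deriv_ball k \<omega> L f}"
  then have F: "at f within {f. deriv_ball k \<omega> L f} \<noteq> bot"
    by (simp add: trivial_limit_within)
  have "deriv_ball k \<omega> L f"
  proof (rule deriv_ball_pointwise_limit[OF assms F, where u = "\<lambda>g. g"])
    show "\<forall>\<^sub>F g in at f within {f. deriv_ball k \<omega> L f}. deriv_ball k \<omega> L g"
      by (simp add: eventually_at_filter)
    show "((\<lambda>g. g x) \<longlongrightarrow> f x) (at f within {f. deriv_ball k \<omega> L f})" for x
      using continuous_on_subset[OF continuous_on_product_coordinates[of x] subset_UNIV]
        continuous_on_product_coordinates[of x]
      by (metis UNIV_I continuous_on_def tendsto_within_subset subset_UNIV)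
  qed
  then show "f \<in> {f. deriv_ball k \<omega> L f}" by simp
qed

section \<open>The isometric isomorphism\<close>

text \<open>The norm is the least \<open>L\<close> with \<open>deriv_ball k \<omega> L f\<close>, so
  its properties follow from those of \<open>deriv_ball\<close> under sums and scalar multiples. The
  inequality for scalar multiples is an equality because it can be applied again to the inverse
  scalar.\<close>

lemma compact_ball_Cb_omega:
  assumes \<omega>: "modulus_of_continuity \<omega>"
  shows "compact_ball_function_space (Cb_omega k \<omega> :: (real^'n::finite \<Rightarrow> real) set) (Cb_omega_norm k \<omega>)"
proof -
  let ?V = "Cb_omega k \<omega> :: (real^'n \<Rightarrow> real) set" and ?N = "Cb_omega_norm k \<omega>"
  note ball = Cb_omega_ball_iff[OF \<omega>, of _ k]
  have in_ball: "deriv_ball k \<omega> (?N f) f" if "f \<in> ?V" for f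
    using ball that by blast
  have scale_le: "?N (c *\<^sub>R f) \<le> \<bar>c\<bar> * ?N f" and scale: "c *\<^sub>R f \<in> ?V" if "f \<in> ?V" for c f
    using deriv_ball_scale[OF in_ball[OF that], of c] ball by blast+
  have eval: "\<bar>f x\<bar> \<le> ?N f" if "f \<in> ?V" for f x
    by (rule deriv_ball_bound[OF in_ball[OF that]])
  show ?thesis
  proof (rule compact_ball_function_space.intro)
    show "seminormed_carrier ?V ?N"
    proof (rule seminormed_carrier.intro)
      show "subspace ?V"
      proof (rule subspaceI)
        show "0 \<in> ?V" using deriv_ball_zero ball by blast
        show "f + g \<in> ?V" if "f \<in> ?V" "g \<in> ?V" for f g
          using deriv_ball_add[OF in_ball in_ball] that ball by blast
      qed (rule scale)
      show "?N (f + g) \<le> ?N f + ?N g" if "f \<in> ?V" "g \<in> ?V" for f g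
        using deriv_ball_add[OF in_ball in_ball] that ball by blast
      show "?N (c *\<^sub>R f) = \<bar>c\<bar> * ?N f" if f: "f \<in> ?V" for f c
      proof (rule antisym[OF scale_le[OF f]])
        show "\<bar>c\<bar> * ?N f \<le> ?N (c *\<^sub>R f)"
        proof (cases "c = 0")
          case True
          then show ?thesis using eval[OF scale[OF f, of c], of 0] by simp
        next
          case False
          have "?N (inverse c *\<^sub>R (c *\<^sub>R f)) \<le> \<bar>inverse c\<bar> * ?N (c *\<^sub>R f)"
            by (rule scale_le[OF scale[OF f]])
          then have "?N f \<le> \<bar>inverse c\<bar> * ?N (c *\<^sub>R f)" using False by simp
          then show ?thesis using False by (simp add: field_simps)
        qed
      qed
    qed
    show "compact_ball_function_space_axioms ?V ?N"
    proof
      show "\<bar>f x\<bar> \<le> ?N f" if "f \<in> ?V" for f x by (rule eval[OF that])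
      show "closed {f \<in> ?V. ?N f \<le> L}" for L
        using closed_deriv_ball[OF \<omega>, of k L] by (simp add: ball)
    qed
  qed
qed

theorem theorem1p2:
  fixes k :: nat and \<omega> :: "real \<Rightarrow> real" and S :: "(real^'n::finite) set"
  assumes "modulus_of_continuity \<omega>" and "closed S"
  shows "isometric_isomorphism
           (dual_space (G_space k \<omega> S) (G_norm k \<omega>)) (dual_norm (G_space k \<omega> S) (G_norm k \<omega>))
           (Cb_omega_on k \<omega> S) (Cb_omega_on_norm k \<omega> S)
           (\<lambda>h. restr S (\<lambda>s. h (delta k \<omega> s)))"
proof -
  interpret compact_ball_function_space "Cb_omega k \<omega> :: (real^'n \<Rightarrow> real) set" "Cb_omega_norm k \<omega>"
    by (rule compact_ball_Cb_omega[OF assms(1)])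
  have delta_eq: "delta k \<omega> = evaluation" by (intro ext) (simp add: delta_def evaluation_def)
  have "G_space k \<omega> S = predual S" by (simp add: G_space_def predual_def G_norm_def delta_eq)
  moreover have "Cb_omega_on_norm k \<omega> S = quotient_norm S"
    by (intro ext) (simp add: Cb_omega_on_norm_def quotient_norm_def)
  ultimately show ?thesis
    using dual_isometric_to_restrictions[of S] by (simp add: Cb_omega_on_def G_norm_def delta_eq)
qed

end
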